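(* Let $X$ be a subshift generated by a recognizable directive sequence $\boldsymbol\tau = (\tau_n \colon \mathcal A_{n+1}^* \to \mathcal A_n^* )_{n\geq0}$ that is decisive. Assume that for all $n \geq 0$ and $a \in \mathcal A_{n+1}$, every word $u \in \mathcal L(X_{\boldsymbol\tau}^{(n)})$ of length $2$ occurs in $\tau_n(a)$. Then a real number $\alpha$ is an eigenvalue of $X$ if and only if there exist letter-coboundaries $c_n \colon \mathcal A_n^* \to \mathbb R$ in $X_{\boldsymbol\tau}^{(n)}$, for each $n \ge 0$, such that $$\sum_{n \ge 0} \max \big\{ \| c_n(u) - \alpha\, h_n(u) \| : a \in \mathcal A_{n+2},\ u \text{ a prefix of } \tau_{n,n+2}(a) \big\} < \infty.$$
   Context: Alphabets are finite sets with at least two elements. $\mathcal A^*$ is the free monoid of finite words over $\mathcal A$ and $|w|$ is the length of $w$. $S$ is the shift map $S((x_k)_k)=(x_{k+1})_k$ on $\mathcal A^{\mathbb Z}$; a subshift is a closed set $X\subseteq\mathcal A^{\mathbb Z}$ with $S(X)=X$; $\mathcal L(X)$ is the set of finite words occurring in points of $X$. A substitution $\tau:\mathcal A^*\to\mathcal B^*$ is a monoid morphism such that $\tau(a)$ is non-empty for every $a\in\mathcal A$ and every $b\in\mathcal B$ occurs in some $\tau(a)$; it acts on $x\in\mathcal A^{\mathbb Z}$ by concatenation, with $\tau(x_0)$ starting at coordinate $0$. A directive sequence $\boldsymbol\tau=(\tau_n)_{n\ge0}$ consists of substitutions $\tau_n:\mathcal A_{n+1}^*\to\mathcal A_n^*$.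 Put $\tau_{n,m}=\tau_n\circ\cdots\circ\tau_{m-1}$ for $m>n$. $X^{(n)}_{\boldsymbol\tau}$ is the set of $x\in\mathcal A_n^{\mathbb Z}$ such that every finite factor of $x$ occurs in $\tau_{n,m}(a)$ for some $m>n$ and $a\in\mathcal A_m$; $X_{\boldsymbol\tau}=X^{(0)}_{\boldsymbol\tau}$; $\boldsymbol\tau$ generates $X$ if $X=X_{\boldsymbol\tau}$. Heights: $h_n(u)=|\tau_{0,n}(u)|$ for $u\in\mathcal A_n^*$, $n\ge1$, and $h_0(u)=|u|$. $\boldsymbol\tau$ is recognizable if, for every $n\ge1$, the sets $S^kB_n(a)$ ($a\in\mathcal A_n$, $0\le k<h_n(a)$) are pairwise disjoint, where $B_n(a)=\{\tau_{0,n}(x):x\in X^{(n)}_{\boldsymbol\tau},\ x_0=a\}$. It is everywhere growing if $\min_{a\in\mathcal A_n}|\tau_{0,n}(a)|\to\infty$ as $n\to\infty$. An everywhere growing $\boldsymbol\tau$ is decisive if for every $n\ge0$ there exist maps $\ell,r:\mathcal A_{n+1}\to\mathcal A_n$ such that, for all letters $a,b$ with $ab\in\mathcal L(X^{(n+1)}_{\boldsymbol\tau})$, the word $\tau_n(b)$ begins with $r(a)$ and $\tau_n(a)$ ends with $\ell(b)$. A return word to a letter $a$ in a subshift $Y\subseteq\mathcal A^{\mathbb Z}$ is a word $w$ such that $wa\in\mathcal L(Y)$ and $wa$ contains exactly two occurrences of $a$, one as a prefix and one as a suffix. A letter-coboundary in $Y$ is a monoid morphism $c:\mathcal A^*\to(\mathbb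 R,+)$ such that $c(w)=0$ for every $a\in\mathcal A$ and every return word $w$ to $a$ in $Y$. A real number $\alpha$ is an eigenvalue (meaning continuous additive eigenvalue) of $X$ if there is a continuous $g:X\to\mathbb R/\mathbb Z$ with $g(Sx)=g(x)+\alpha \pmod{\mathbb Z}$ for all $x\in X$. For $x\in\mathbb R$, $\|x\|$ is the distance from $x$ to the nearest integer.
   Formalization: The formal theorem additionally assumes that, for every n, each letter of A_n occurs in the language of X^(n); without this the statement fails, since letters absent from X^(n) can make the sum diverge even when α is an eigenvalue. *)

theory Defs
  imports "HOL-Analysis.Analysis" "HOL-Library.Sublist" "HOL-Library.Disjoint_Sets"
begin

section \<open>The circle group of reals modulo integers\<close>

quotient_type circle = real / "\<lambda>x y :: real. x - y \<in> \<int>"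
  morphisms rep_circle to_circle
proof (rule equivpI)
  show "reflp (\<lambda>x y :: real. x - y \<in> \<int>)"
    by (simp add: reflp_def)
  show "symp (\<lambda>x y :: real. x - y \<in> \<int>)"
    by (metis (no_types, lifting) Ints_minus minus_diff_eq sympI)
  show "transp (\<lambda>x y :: real. x - y \<in> \<int>)"
  proof (rule transpI)
    fix x y z :: real
    assume "x - y \<in> \<int>" "y - z \<in> \<int>"
    then have "(x - y) + (y - z) \<in> \<int>" by (rule Ints_add)
    then show "x - z \<in> \<int>" by simp
  qed
qed

instantiation circle :: ab_group_add
begin

lift_definition zero_circle :: circle is "0 :: real" .

lift_definition plus_circle :: "circle \<Rightarrow> circle \<Rightarrow> circle" is "(+) :: real \<Rightarrow> real \<Rightarrow> real"
  by (metis Ints_add add_diff_add)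

lift_definition uminus_circle :: "circle \<Rightarrow> circle" is "uminus :: real \<Rightarrow> real"
  by (metis Ints_minus minus_diff_minus)

lift_definition minus_circle :: "circle \<Rightarrow> circle \<Rightarrow> circle" is "(-) :: real \<Rightarrow> real \<Rightarrow> real"
  by (metis Ints_diff diff_diff_eq diff_diff_eq2 add.commute add_diff_eq diff_add_eq)

instance
  by standard (transfer, simp add: algebra_simps)+

end

instantiation circle :: topological_space
begin

text \<open>The quotient topology of the real line.\<close>

definition open_circle :: "circle set \<Rightarrow> bool"
  where "open_circle U \<longleftrightarrow> open (to_circle -` U)"

instance
  by standard (auto simp: open_circle_def vimage_Int vimage_Union)

end

definition int_dist :: "real \<Rightarrow> real"
  where "int_dist x = infdist x \<int>"


section \<open>Words and subshifts\<close>

definition alphabet :: "'a set \<Rightarrow> bool"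
  where "alphabet A \<longleftrightarrow> finite A \<and> 2 \<le> card A"

definition full_shift :: "'a set \<Rightarrow> (int \<Rightarrow> 'a) topology"
  where "full_shift A = product_topology (\<lambda>_ :: int. discrete_topology A) UNIV"

definition shift :: "(int \<Rightarrow> 'a) \<Rightarrow> int \<Rightarrow> 'a"
  where "shift x = (\<lambda>k. x (k + 1))"

definition subshift :: "'a set \<Rightarrow> (int \<Rightarrow> 'a) set \<Rightarrow> bool"
  where "subshift A X \<longleftrightarrow> closedin (full_shift A) X \<and> shift ` X = X"

text \<open>\<open>factor x i j\<close> is the word \<open>x\<^sub>i \<dots> x\<^sub>j\<^sub>-\<^sub>1\<close>; it is empty if \<open>j \<le> i\<close>.\<close>

definition factor :: "(int \<Rightarrow> 'a) \<Rightarrow> int \<Rightarrow> int \<Rightarrow> 'a list"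
  where "factor x i j = map x [i..j - 1]"

definition language :: "(int \<Rightarrow> 'a) set \<Rightarrow> 'a list set"
  where "language X = {factor x i j | x i j. x \<in> X}"


section \<open>Substitutions and directive sequences\<close>

definition substitution :: "'a set \<Rightarrow> 'b set \<Rightarrow> ('a list \<Rightarrow> 'b list) \<Rightarrow> bool"
  where "substitution A B \<tau> \<longleftrightarrow>
    (\<forall>u \<in> lists A. \<tau> u \<in> lists B) \<and>
    \<tau> [] = [] \<and>
    (\<forall>u \<in> lists A. \<forall>v \<in> lists A. \<tau> (u @ v) = \<tau> u @ \<tau> v) \<and>
    (\<forall>a \<in> A. \<tau> [a] \<noteq> []) \<and>
    (\<forall>b \<in> B. \<exists>a \<in> A. b \<in> set (\<tau> [a]))"

text \<open>
  The action on bi-infinite sequences. As images of letters are non-empty, coordinate \<open>k \<ge> 0\<close> of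
  the image lies in \<open>\<tau> (x\<^sub>0 \<dots> x\<^sub>k)\<close>, read from its left end, and coordinate \<open>k < 0\<close> lies
  in \<open>\<tau> (x\<^sub>k \<dots> x\<^sub>-\<^sub>1)\<close>, read from its right end.
\<close>

definition subst_seq :: "('a list \<Rightarrow> 'b list) \<Rightarrow> (int \<Rightarrow> 'a) \<Rightarrow> int \<Rightarrow> 'b"
  where "subst_seq \<tau> x = (\<lambda>k.
    if 0 \<le> k then \<tau> (factor x 0 (k + 1)) ! nat k
    else \<tau> (factor x k 0) ! nat (int (length (\<tau> (factor x k 0))) + k))"

definition directive_sequence :: "(nat \<Rightarrow> 'a set) \<Rightarrow> (nat \<Rightarrow> 'a list \<Rightarrow> 'a list) \<Rightarrow> bool"
  where "directive_sequence A \<tau> \<longleftrightarrow>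
    (\<forall>n. alphabet (A n) \<and> substitution (A (Suc n)) (A n) (\<tau> n))"

text \<open>\<open>comp_subst \<tau> n m\<close> is \<open>\<tau>\<^sub>n \<circ> \<dots> \<circ> \<tau>\<^sub>m\<^sub>-\<^sub>1\<close>, and the identity if \<open>m \<le> n\<close>.\<close>

primrec comp_subst :: "(nat \<Rightarrow> 'a list \<Rightarrow> 'a list) \<Rightarrow> nat \<Rightarrow> nat \<Rightarrow> 'a list \<Rightarrow> 'a list"
  where
    "comp_subst \<tau> n 0 = id"
  | "comp_subst \<tau> n (Suc m) = (if n \<le> m then comp_subst \<tau> n m \<circ> \<tau> m else id)"

definition level_shift ::
    "(nat \<Rightarrow> 'a set) \<Rightarrow> (nat \<Rightarrow> 'a list \<Rightarrow> 'a list) \<Rightarrow> nat \<Rightarrow> (int \<Rightarrow> 'a) set"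
  where "level_shift A \<tau> n = {x. range x \<subseteq> A n \<and>
    (\<forall>i j. \<exists>m > n. \<exists>a \<in> A m. sublist (factor x i j) (comp_subst \<tau> n m [a]))}"

definition generates ::
    "(nat \<Rightarrow> 'a set) \<Rightarrow> (nat \<Rightarrow> 'a list \<Rightarrow> 'a list) \<Rightarrow> (int \<Rightarrow> 'a) set \<Rightarrow> bool"
  where "generates A \<tau> X \<longleftrightarrow> X = level_shift A \<tau> 0"

definition height :: "(nat \<Rightarrow> 'a list \<Rightarrow> 'a list) \<Rightarrow> nat \<Rightarrow> 'a list \<Rightarrow> nat"
  where "height \<tau> n u = length (comp_subst \<tau> 0 n u)"

definition base ::
    "(nat \<Rightarrow> 'a set) \<Rightarrow> (nat \<Rightarrow> 'a list \<Rightarrow> 'a list) \<Rightarrow> nat \<Rightarrow> 'a \<Rightarrow> (int \<Rightarrow> 'a) set"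
  where "base A \<tau> n a =
    {subst_seq (comp_subst \<tau> 0 n) x | x. x \<in> level_shift A \<tau> n \<and> x 0 = a}"

definition recognizable :: "(nat \<Rightarrow> 'a set) \<Rightarrow> (nat \<Rightarrow> 'a list \<Rightarrow> 'a list) \<Rightarrow> bool"
  where "recognizable A \<tau> \<longleftrightarrow> (\<forall>n \<ge> 1.
    disjoint_family_on (\<lambda>(a, k). (shift ^^ k) ` base A \<tau> n a)
      {(a, k). a \<in> A n \<and> k < height \<tau> n [a]})"

definition everywhere_growing :: "(nat \<Rightarrow> 'a set) \<Rightarrow> (nat \<Rightarrow> 'a list \<Rightarrow> 'a list) \<Rightarrow> bool"
  where "everywhere_growing A \<tau> \<longleftrightarrow>
    filterlim (\<lambda>n. Min ((\<lambda>a. length (comp_subst \<tau> 0 n [a])) ` A n)) at_top sequentially"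

definition decisive :: "(nat \<Rightarrow> 'a set) \<Rightarrow> (nat \<Rightarrow> 'a list \<Rightarrow> 'a list) \<Rightarrow> bool"
  where "decisive A \<tau> \<longleftrightarrow> everywhere_growing A \<tau> \<and>
    (\<forall>n. \<exists>l \<in> A (Suc n) \<rightarrow> A n. \<exists>r \<in> A (Suc n) \<rightarrow> A n.
      \<forall>a \<in> A (Suc n). \<forall>b \<in> A (Suc n). [a, b] \<in> language (level_shift A \<tau> (Suc n)) \<longrightarrow>
        prefix [r a] (\<tau> n [b]) \<and> suffix [l b] (\<tau> n [a]))"


section \<open>Letter-coboundaries and eigenvalues\<close>

definition return_word :: "(int \<Rightarrow> 'a) set \<Rightarrow> 'a \<Rightarrow> 'a list \<Rightarrow> bool"
  where "return_word Y a w \<longleftrightarrow>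
    w @ [a] \<in> language Y \<and> count_list (w @ [a]) a = 2 \<and>
    prefix [a] (w @ [a]) \<and> suffix [a] (w @ [a])"

definition letter_coboundary :: "'a set \<Rightarrow> (int \<Rightarrow> 'a) set \<Rightarrow> ('a list \<Rightarrow> real) \<Rightarrow> bool"
  where "letter_coboundary A Y c \<longleftrightarrow>
    c [] = 0 \<and>
    (\<forall>u \<in> lists A. \<forall>v \<in> lists A. c (u @ v) = c u + c v) \<and>
    (\<forall>a \<in> A. \<forall>w. return_word Y a w \<longrightarrow> c w = 0)"

definition eigenvalue :: "'a set \<Rightarrow> (int \<Rightarrow> 'a) set \<Rightarrow> real \<Rightarrow> bool"
  where "eigenvalue A X \<alpha> \<longleftrightarrow>
    (\<exists>g :: (int \<Rightarrow> 'a) \<Rightarrow> circle.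
      continuous_map (subtopology (full_shift A) X) euclidean g \<and>
      (\<forall>x \<in> X. g (shift x) = g x + to_circle \<alpha>))"

text \<open>
  The convention that the alphabet of level \<open>n\<close> has no letter that is absent from the subshift of
  level \<open>n\<close>. This is not automatic: a letter may occur only at the very left end of the words
  \<open>\<tau>\<^sub>n \<circ> \<dots> \<circ> \<tau>\<^sub>m\<^sub>-\<^sub>1 (a)\<close>, and the image of such a letter need not be in the language.
\<close>

definition letters_occur :: "(nat \<Rightarrow> 'a set) \<Rightarrow> (nat \<Rightarrow> 'a list \<Rightarrow> 'a list) \<Rightarrow> bool"
  where "letters_occur A \<tau> \<longleftrightarrow> (\<forall>n. \<forall>a \<in> A n. [a] \<in> language (level_shift A \<tau> n))"

end

theory Submission
  imports Defs
begin

text \<open>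
  Write \<open>S\<close> for the shift, \<open>B\<^sub>n(a)\<close> for the base of the letter \<open>a\<close> at level \<open>n\<close>, \<open>h\<^sub>n\<close> for the heights and
  \<open>\<pi>\<^sub>n(b)\<close> for the first letter of \<open>\<tau>\<^sub>n(b)\<close>. The proof compares the values of an eigenfunction on the bases of
  different levels, and two facts make this comparison possible.

  For each \<open>n \<ge> 1\<close> the sets \<open>S\<^sup>k B\<^sub>n(a)\<close> with \<open>k < h\<^sub>n(a)\<close> partition \<open>X\<close> into finitely many open sets: they cover
  \<open>X\<close> by compactness (\<open>tower_cover\<close>), are disjoint by recognizability (\<open>tower_unique\<close>), and the compactness
  argument of the covering shows that they are open (\<open>tower_open\<close>). Secondly, a letter-coboundary \<open>c\<^sub>n\<close> is a
  difference of potentials, \<open>c\<^sub>n(a) = \<rho>\<^sub>n(b) - \<rho>\<^sub>n(a)\<close> whenever \<open>ab\<close> is in the language (\<open>coboundary_potential\<close>),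
  so that its value on a word depends only on the first letter of the word and on the letter that follows it.

  From coboundaries to an eigenvalue. Let \<open>e\<^sub>n\<close> be the terms of the given series. As every letter of level \<open>n + 1\<close>
  occurs in the image of every letter of level \<open>n + 2\<close>, the function \<open>w \<mapsto> \<rho>\<^sub>n\<^sub>+\<^sub>1(w) - \<rho>\<^sub>n(\<pi>\<^sub>n(w))\<close> is constant modulo \<open>1\<close>
  up to \<open>e\<^sub>n + e\<^sub>n\<^sub>+\<^sub>1\<close>, and adding constants to the potentials makes these constants vanish
  (\<open>coherent_potentials\<close>). Put \<open>F\<^sub>n(x) = \<alpha> k + \<rho>\<^sub>n(a)\<close> for \<open>x \<in> S\<^sup>k B\<^sub>n(a)\<close>. Then \<open>F\<^sub>n\<close> is locally constant,
  \<open>F\<^sub>n\<^sub>+\<^sub>1 - F\<^sub>n\<close> is at most \<open>3 e\<^sub>n + e\<^sub>n\<^sub>+\<^sub>1\<close> modulo \<open>1\<close>, and \<open>F\<^sub>n(S x) - F\<^sub>n(x) - \<alpha>\<close> is \<open>0\<close> inside a tower and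
  \<open>c\<^sub>n(a) - \<alpha> h\<^sub>n(a)\<close> at its top. Hence the \<open>F\<^sub>n\<close> converge uniformly modulo \<open>1\<close> to an eigenfunction
  (\<open>eigenvalue_of_coboundaries\<close>).

  From an eigenvalue to coboundaries. Decisiveness forces the diameters of the bases to tend to zero, so for large \<open>n\<close>
  the eigenfunction \<open>g\<close> maps \<open>B\<^sub>n(a)\<close> into a short arc of the circle (\<open>small_oscillation\<close>). Let \<open>M\<^sub>n(a)\<close> be the upper end and \<open>w\<^sub>n(a)\<close>
  the length of the shortest such arc. Decisiveness also implies that \<open>\<pi>\<^sub>n\<^sub>-\<^sub>1(b)\<close> is determined by the letter that precedes
  \<open>b\<close>; therefore \<open>b \<mapsto> M\<^sub>n\<^sub>-\<^sub>1(\<pi>\<^sub>n\<^sub>-\<^sub>1(b))\<close> is the potential of a letter-coboundary \<open>c\<^sub>n\<close>. If \<open>u\<close> is a prefix of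
  \<open>\<tau>\<^sub>n(\<tau>\<^sub>n\<^sub>+\<^sub>1(a))\<close>, the shift by \<open>0\<close> and the shift by \<open>h\<^sub>n(u)\<close> both map \<open>B\<^sub>n\<^sub>+\<^sub>2(a)\<close> into bases of level \<open>n - 1\<close>. An arc that lies
  inside another one after a rotation has its upper end within the difference of the two lengths (\<open>shortest_arc_translate\<close>).
  So \<open>c\<^sub>n(u) - \<alpha> h\<^sub>n(u)\<close> is, modulo \<open>1\<close>, at most the sum of two differences \<open>w\<^sub>n\<^sub>-\<^sub>1(b) - w\<^sub>n\<^sub>+\<^sub>2(a)\<close>. Since every letter occurs in every
  image, all \<open>w\<^sub>n\<^sub>+\<^sub>1(a)\<close> are at most all \<open>w\<^sub>n(b)\<close>, and the bound becomes \<open>2 (W\<^sub>n\<^sub>-\<^sub>1 - W\<^sub>n\<^sub>+\<^sub>3)\<close> for the maxima \<open>W\<^sub>n\<close>, whose sum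
  telescopes (\<open>coboundaries_of_eigenfunction\<close>).
\<close>

section \<open>The distance to the nearest integer\<close>

lemma int_dist_nonneg: "0 \<le> int_dist x"
  by (simp add: int_dist_def infdist_nonneg)

lemma int_dist_le: "int_dist x \<le> \<bar>x - of_int k\<bar>"
  unfolding int_dist_def by (rule infdist_le2[of "of_int k"]) (auto simp: dist_real_def)

lemma int_dist_le_abs: "int_dist x \<le> \<bar>x\<bar>"
  using int_dist_le[of x 0] by simp

lemma int_dist_attained: "\<exists>k::int. int_dist x = \<bar>x - of_int k\<bar>"
proof -
  obtain z :: real where "z \<in> \<int>" "infdist x \<int> = dist x z"
    using infdist_attains_inf[OF closed_Ints, of x] Ints_0 by blast
  then show ?thesis by (auto simp: int_dist_def dist_real_def elim!: Ints_cases)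
qed

lemma int_dist_add_int: "int_dist (x + of_int m) = int_dist x"
proof (rule antisym)
  obtain k where "int_dist x = \<bar>x - of_int k\<bar>" using int_dist_attained by blast
  then show "int_dist (x + of_int m) \<le> int_dist x" using int_dist_le[of "x + of_int m" "k + m"] by simp
  obtain k where "int_dist (x + of_int m) = \<bar>x + of_int m - of_int k\<bar>" using int_dist_attained by blast
  then show "int_dist x \<le> int_dist (x + of_int m)" using int_dist_le[of x "k - m"]
    by (simp add: algebra_simps)
qed

lemma int_dist_cong: "x - y \<in> \<int> \<Longrightarrow> int_dist x = int_dist y"
  by (metis Ints_cases add.commute diff_add_cancel int_dist_add_int)

lemma int_dist_minus: "int_dist (- x) = int_dist x"
proof -
  have "int_dist (- y) \<le> int_dist y" for y
  proof -
    obtain k where "int_dist y = \<bar>y - of_int k\<bar>" using int_dist_attained by blast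
    then show ?thesis using int_dist_le[of "-y" "-k"] by simp
  qed
  from this[of x] this[of "-x"] show ?thesis by simp
qed

lemma int_dist_minus_commute: "int_dist (x - y) = int_dist (y - x)"
  using int_dist_minus[of "x - y"] by simp

lemma int_dist_triangle: "int_dist (x + y) \<le> int_dist x + int_dist y"
proof -
  obtain k l where "int_dist x = \<bar>x - of_int k\<bar>" "int_dist y = \<bar>y - of_int l\<bar>"
    using int_dist_attained by metis
  then show ?thesis using int_dist_le[of "x + y" "k + l"] by simp
qed

lemma int_dist_triangle_diff: "int_dist (x - z) \<le> int_dist (x - y) + int_dist (y - z)"
  using int_dist_triangle[of "x - y" "y - z"] by simp

lemma int_dist_eq_0: "int_dist x = 0 \<longleftrightarrow> x \<in> \<int>"
  by (metis Ints_0 Ints_cases abs_eq_0 diff_zero eq_iff_diff_eq_0 Ints_of_int int_dist_attained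
      int_dist_cong int_dist_le_abs int_dist_nonneg abs_0 order_antisym)

lemma open_int_dist_less: "open {s. int_dist (s - t) < e}"
  unfolding int_dist_def by (intro open_Collect_less continuous_intros)

lemma to_circle_eq_iff: "to_circle s = to_circle t \<longleftrightarrow> s - t \<in> \<int>"
  by (rule circle.abs_eq_iff)

lemma to_circle_add: "to_circle (s + t) = to_circle s + to_circle t"
  by (simp add: plus_circle.abs_eq)

lemma to_circle_rep: "to_circle (rep_circle q) = q"
  by (rule Quotient_abs_rep[OF Quotient_circle])

lemma rep_to_circle: "rep_circle (to_circle t) - t \<in> \<int>"
  using to_circle_eq_iff to_circle_rep by blast

section \<open>Words read off a bi-infinite sequence\<close>

lemma length_factor [simp]: "length (factor x i j) = nat (j - i)"
  by (simp add: factor_def)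

lemma nth_factor: "int t < j - i \<Longrightarrow> factor x i j ! t = x (i + int t)"
  by (simp add: factor_def)

lemma set_factor: "set (factor x i j) = x ` {i..<j}"
  by (auto simp: factor_def)

lemma factor_in_lists: "range x \<subseteq> A \<Longrightarrow> factor x i j \<in> lists A"
  by (fastforce simp: factor_def)

lemma factor_append: "i \<le> j \<Longrightarrow> j \<le> k \<Longrightarrow> factor x i k = factor x i j @ factor x j k"
  by (rule nth_equalityI) (auto simp: nth_factor nth_append add.commute)

lemma factor_empty [simp]: "j \<le> i \<Longrightarrow> factor x i j = []"
  by (simp add: factor_def)

lemma factor_single [simp]: "factor x i (i + 1) = [x i]"
  by (simp add: factor_def)

lemma factor_translate: "factor (\<lambda>k. x (k + p)) i j = factor x (i + p) (j + p)"
  by (rule nth_equalityI) (auto simp: nth_factor add_ac)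

lemma shift_funpow: "(shift ^^ k) x = (\<lambda>i. x (i + int k))"
  by (induction k) (auto simp: shift_def algebra_simps)

lemma factor_cong: "(\<And>k. i \<le> k \<Longrightarrow> k < j \<Longrightarrow> x k = y k) \<Longrightarrow> factor x i j = factor y i j"
  by (auto simp: factor_def)

lemma sublist_factor: "i' \<le> i \<Longrightarrow> j \<le> j' \<Longrightarrow> sublist (factor x i j) (factor x i' j')"
proof (cases "i \<le> j")
  case True
  assume "i' \<le> i" "j \<le> j'"
  then have "factor x i' j' = factor x i' i @ factor x i j @ factor x j j'"
    using True factor_append[of i' i j' x] factor_append[of i j j' x] by simp
  then show ?thesis by auto
qed simp

lemma factor_prefix:
  assumes "factor z 0 (int (length w)) = w" "w = u @ v"
  shows "factor z 0 (int (length u)) = u" "v \<noteq> [] \<Longrightarrow> z (int (length u)) = hd v"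
proof -
  have zn: "z (int i) = w ! i" if "i < length w" for i
    using nth_factor[of i "int (length w)" 0 z] that assms(1) by simp
  show "factor z 0 (int (length u)) = u"
    by (rule nth_equalityI) (simp_all add: nth_factor zn assms(2) nth_append)
  show "z (int (length u)) = hd v" if "v \<noteq> []"
    using zn[of "length u"] that by (simp add: assms(2) hd_conv_nth nth_append)
qed

section \<open>Substitutions acting on sequences\<close>

lemma substitution_append:
  "substitution A B \<sigma> \<Longrightarrow> u \<in> lists A \<Longrightarrow> v \<in> lists A \<Longrightarrow> \<sigma> (u @ v) = \<sigma> u @ \<sigma> v"
  by (simp add: substitution_def)

lemma substitution_Nil: "substitution A B \<sigma> \<Longrightarrow> \<sigma> [] = []"
  by (simp add: substitution_def)

lemma substitution_lists: "substitution A B \<sigma> \<Longrightarrow> u \<in> lists A \<Longrightarrow> \<sigma> u \<in> lists B"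
  unfolding substitution_def by blast

lemma substitution_nonempty: "substitution A B \<sigma> \<Longrightarrow> a \<in> A \<Longrightarrow> \<sigma> [a] \<noteq> []"
  by (simp add: substitution_def)

lemma substitution_onto: "substitution A B \<sigma> \<Longrightarrow> b \<in> B \<Longrightarrow> \<exists>a\<in>A. b \<in> set (\<sigma> [a])"
  by (simp add: substitution_def)

lemma substitution_id: "substitution A A id"
  by (auto simp: substitution_def)

lemma substitution_comp:
  assumes \<tau>: "substitution A B \<tau>" and \<sigma>: "substitution B C \<sigma>"
  shows "substitution A C (\<sigma> \<circ> \<tau>)"
proof -
  have ne: "\<sigma> w \<noteq> []" if "w \<in> lists B" "w \<noteq> []" for w
  proof (cases w)
    case (Cons b v)
    then have "\<sigma> w = \<sigma> [b] @ \<sigma> v" using substitution_append[OF \<sigma>, of "[b]" v] that by simp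
    then show ?thesis using substitution_nonempty[OF \<sigma>, of b] that Cons by simp
  qed (use that in simp)
  have "\<exists>a\<in>A. c \<in> set (\<sigma> (\<tau> [a]))" if c: "c \<in> C" for c
  proof -
    obtain b where b: "b \<in> B" "c \<in> set (\<sigma> [b])" using substitution_onto[OF \<sigma> c] by blast
    obtain a where a: "a \<in> A" "b \<in> set (\<tau> [a])" using substitution_onto[OF \<tau> b(1)] by blast
    obtain p s where ps: "\<tau> [a] = p @ [b] @ s" using split_list[OF a(2)] by auto
    have "\<tau> [a] \<in> lists B" using substitution_lists[OF \<tau>, of "[a]"] a by simp
    then have "\<sigma> (\<tau> [a]) = \<sigma> p @ \<sigma> [b] @ \<sigma> s" using ps
      substitution_append[OF \<sigma>, of p "[b] @ s"] substitution_append[OF \<sigma>, of "[b]" s] by simp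
    then have "c \<in> set (\<sigma> (\<tau> [a]))" using b by simp
    then show ?thesis using a(1) by blast
  qed
  then show ?thesis using \<tau> \<sigma> ne
    unfolding substitution_def comp_apply by (metis Cons_in_lists_iff lists.Nil)
qed

lemma substitution_prefix:
  assumes "substitution A B \<sigma>" "v \<in> lists A" "prefix u v"
  shows "prefix (\<sigma> u) (\<sigma> v)"
proof -
  obtain s where "v = u @ s" using assms(3) by (auto simp: prefix_def)
  then have "\<sigma> v = \<sigma> u @ \<sigma> s" using assms(2) substitution_append[OF assms(1), of u s] by simp
  then show ?thesis by simp
qed

lemma substitution_sublist:
  assumes "substitution A B \<sigma>" "v \<in> lists A" "sublist u v"
  shows "sublist (\<sigma> u) (\<sigma> v)"
proof -
  obtain p s where "v = p @ u @ s" using assms(3) by (auto simp: sublist_def)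
  then have "\<sigma> v = \<sigma> p @ \<sigma> u @ \<sigma> s" using assms(2)
    substitution_append[OF assms(1), of p "u @ s"] substitution_append[OF assms(1), of u s] by simp
  then show ?thesis by auto
qed

lemma length_substitution_ge:
  assumes "substitution A B \<sigma>"
  shows "u \<in> lists A \<Longrightarrow> length u \<le> length (\<sigma> u)"
proof (induction u)
  case (Cons a u)
  then have "\<sigma> (a # u) = \<sigma> [a] @ \<sigma> u" using substitution_append[OF assms, of "[a]" u] by simp
  moreover have "1 \<le> length (\<sigma> [a])"
    using substitution_nonempty[OF assms, of a] Cons by (simp add: Suc_le_eq)
  ultimately show ?case using Cons by simp
qed simp

lemma length_substitution_le:
  assumes "substitution A B \<sigma>" and "\<And>a. a \<in> A \<Longrightarrow> length (\<sigma> [a]) \<le> H"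
  shows "u \<in> lists A \<Longrightarrow> length (\<sigma> u) \<le> H * length u"
proof (induction u)
  case Nil
  then show ?case by (simp add: substitution_Nil[OF assms(1)])
next
  case (Cons a u)
  then have "\<sigma> (a # u) = \<sigma> [a] @ \<sigma> u" using substitution_append[OF assms(1), of "[a]" u] by simp
  then show ?case using Cons assms(2)[of a] by simp
qed

text \<open>
  The signed coordinate at which the image of the letter \<open>y\<^sub>i\<close> starts in \<open>subst_seq \<sigma> y\<close>. With it the two
  cases in the definition of \<open>subst_seq\<close> become one (\<open>subst_seq_nth\<close> and \<open>factor_subst_seq\<close>).
\<close>

definition cut :: "('a list \<Rightarrow> 'b list) \<Rightarrow> (int \<Rightarrow> 'a) \<Rightarrow> int \<Rightarrow> int"
  where "cut \<sigma> y i = (if 0 \<le> i then int (length (\<sigma> (factor y 0 i)))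
    else - int (length (\<sigma> (factor y i 0))))"

lemma substitution_factor_append:
  assumes "substitution A B \<sigma>" "range y \<subseteq> A" "i \<le> j" "j \<le> k"
  shows "\<sigma> (factor y i k) = \<sigma> (factor y i j) @ \<sigma> (factor y j k)"
  using assms factor_append[of i j k y] substitution_append[OF assms(1)] factor_in_lists[OF assms(2)] by metis

lemma cut_diff:
  assumes "substitution A B \<sigma>" "range y \<subseteq> A" "i \<le> j"
  shows "cut \<sigma> y j - cut \<sigma> y i = int (length (\<sigma> (factor y i j)))"
proof -
  note sp = substitution_factor_append[OF assms(1,2)]
  consider "0 \<le> i" | "j < 0" | "i < 0" "0 \<le> j" by linarith
  then show ?thesis
  proof cases
    case 1
    then show ?thesis using sp[of 0 i j] assms(3) by (simp add: cut_def)
  next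
    case 2
    then show ?thesis using sp[of i j 0] assms(3) by (simp add: cut_def)
  next
    case 3
    then show ?thesis using sp[of i 0 j] by (simp add: cut_def)
  qed
qed

lemma cut_0 [simp]: "substitution A B \<sigma> \<Longrightarrow> cut \<sigma> y 0 = 0"
  by (simp add: cut_def substitution_Nil)

lemma cut_diff_ge:
  assumes "substitution A B \<sigma>" "range y \<subseteq> A" "i \<le> j"
  shows "j - i \<le> cut \<sigma> y j - cut \<sigma> y i"
  using cut_diff[OF assms] length_substitution_ge[OF assms(1) factor_in_lists[OF assms(2), of i j]]
  by simp

text \<open>
  Reading coordinate \<open>t\<close> of the image from a larger window of \<open>y\<close> gives the same letter. This makes all windows comparable,
  in particular the two windows that \<open>subst_seq\<close> uses.
\<close>

lemma nth_window:
  assumes "substitution A B \<sigma>" "range y \<subseteq> A" "i' \<le> i" "i \<le> j" "j \<le> j'"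
    "cut \<sigma> y i \<le> t" "t < cut \<sigma> y j"
  shows "\<sigma> (factor y i' j') ! nat (t - cut \<sigma> y i') = \<sigma> (factor y i j) ! nat (t - cut \<sigma> y i)"
proof -
  have eq: "\<sigma> (factor y i' j') = \<sigma> (factor y i' i) @ \<sigma> (factor y i j) @ \<sigma> (factor y j j')"
    using substitution_factor_append[OF assms(1,2)] assms(3-5) by (metis order_trans)
  have l: "int (length (\<sigma> (factor y i' i))) = cut \<sigma> y i - cut \<sigma> y i'"
    "int (length (\<sigma> (factor y i j))) = cut \<sigma> y j - cut \<sigma> y i"
    using cut_diff[OF assms(1,2)] assms(3-5) by auto
  have "nat (t - cut \<sigma> y i') = length (\<sigma> (factor y i' i)) + nat (t - cut \<sigma> y i)"
    using l assms(6,7) by linarith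
  moreover have "nat (t - cut \<sigma> y i) < length (\<sigma> (factor y i j))"
    using l assms(6,7) by linarith
  ultimately show ?thesis unfolding eq by (simp add: nth_append)
qed

lemma subst_seq_nth:
  assumes "substitution A B \<sigma>" "range y \<subseteq> A" "i \<le> j" "cut \<sigma> y i \<le> t" "t < cut \<sigma> y j"
  shows "subst_seq \<sigma> y t = \<sigma> (factor y i j) ! nat (t - cut \<sigma> y i)"
proof -
  define p q where "p = (if 0 \<le> t then 0 else t)" and "q = (if 0 \<le> t then t + 1 else 0)"
  have pq: "p \<le> q" by (auto simp: p_def q_def)
  have c: "cut \<sigma> y p \<le> t" "t < cut \<sigma> y q"
    using cut_diff_ge[OF assms(1,2), of 0 "t + 1"] cut_diff_ge[OF assms(1,2), of t 0] cut_0[OF assms(1)]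
    by (auto simp: p_def q_def)
  have "subst_seq \<sigma> y t = \<sigma> (factor y p q) ! nat (t - cut \<sigma> y p)"
    using cut_0[OF assms(1), of y] by (auto simp: subst_seq_def p_def q_def cut_def substitution_Nil[OF assms(1)] add.commute)
  also have "\<dots> = \<sigma> (factor y (min i p) (max j q)) ! nat (t - cut \<sigma> y (min i p))"
    by (rule nth_window[OF assms(1,2), symmetric]) (use pq c in auto)
  also have "\<dots> = \<sigma> (factor y i j) ! nat (t - cut \<sigma> y i)"
    by (rule nth_window[OF assms(1,2)]) (use assms in auto)
  finally show ?thesis .
qed

lemma factor_subst_seq:
  assumes "substitution A B \<sigma>" "range y \<subseteq> A" "i \<le> j"
  shows "factor (subst_seq \<sigma> y) (cut \<sigma> y i) (cut \<sigma> y j) = \<sigma> (factor y i j)"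
proof (rule nth_equalityI)
  show "length (factor (subst_seq \<sigma> y) (cut \<sigma> y i) (cut \<sigma> y j)) = length (\<sigma> (factor y i j))"
    using cut_diff[OF assms] by simp
  fix t assume "t < length (factor (subst_seq \<sigma> y) (cut \<sigma> y i) (cut \<sigma> y j))"
  then have t: "int t < cut \<sigma> y j - cut \<sigma> y i" by simp
  then show "factor (subst_seq \<sigma> y) (cut \<sigma> y i) (cut \<sigma> y j) ! t = \<sigma> (factor y i j) ! t"
    using subst_seq_nth[OF assms, of "cut \<sigma> y i + int t"] by (simp add: nth_factor)
qed

lemma cut_bounds:
  assumes "substitution A B \<sigma>" "range y \<subseteq> A"
  shows "cut \<sigma> y (min t 0) \<le> t" "t < cut \<sigma> y (max (t + 1) 0)"
  using cut_diff_ge[OF assms, of "min t 0" 0] cut_diff_ge[OF assms, of 0 "max (t+1) 0"] cut_0[OF assms(1)]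
  by (auto simp: min_def max_def split: if_splits)

lemma range_subst_seq:
  assumes "substitution A B \<sigma>" "range y \<subseteq> A"
  shows "range (subst_seq \<sigma> y) \<subseteq> B"
proof
  fix b assume "b \<in> range (subst_seq \<sigma> y)"
  then obtain t where t: "b = subst_seq \<sigma> y t" by auto
  define i j :: int where "i = min t 0" and "j = max (t + 1) 0"
  have ij: "i \<le> j" "cut \<sigma> y i \<le> t" "t < cut \<sigma> y j" using cut_bounds[OF assms, of t] by (auto simp: i_def j_def)
  have "b \<in> set (factor (subst_seq \<sigma> y) (cut \<sigma> y i) (cut \<sigma> y j))"
    using ij t by (auto simp: set_factor)
  then have "b \<in> set (\<sigma> (factor y i j))" using factor_subst_seq[OF assms ij(1)] by simp
  then show "b \<in> B" using substitution_lists[OF assms(1) factor_in_lists[OF assms(2), of i j]] by auto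
qed

lemma cut_comp:
  assumes "substitution A B \<tau>" "substitution B C \<sigma>" "range y \<subseteq> A"
  shows "cut \<sigma> (subst_seq \<tau> y) (cut \<tau> y i) = cut (\<sigma> \<circ> \<tau>) y i"
proof (cases "0 \<le> i")
  case True
  then have "factor (subst_seq \<tau> y) 0 (cut \<tau> y i) = \<tau> (factor y 0 i)"
    using factor_subst_seq[OF assms(1,3), of 0 i] cut_0[OF assms(1)] by simp
  moreover have "0 \<le> cut \<tau> y i" using True by (simp add: cut_def)
  ultimately show ?thesis using True by (simp add: cut_def[of _ _ i] cut_def[of \<sigma>] del: length_factor)
next
  case False
  then have *: "factor (subst_seq \<tau> y) (cut \<tau> y i) 0 = \<tau> (factor y i 0)"
    using factor_subst_seq[OF assms(1,3), of i 0] cut_0[OF assms(1), of y] by simp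
  have **: "cut \<tau> y i < 0" using False cut_diff_ge[OF assms(1,3), of i 0] cut_0[OF assms(1), of y] by simp
  show ?thesis unfolding cut_def[of \<sigma>] cut_def[of "\<sigma> \<circ> \<tau>"] using False * ** by simp
qed

lemma subst_seq_comp:
  assumes "substitution A B \<tau>" "substitution B C \<sigma>" "range y \<subseteq> A"
  shows "subst_seq (\<sigma> \<circ> \<tau>) y = subst_seq \<sigma> (subst_seq \<tau> y)"
proof
  fix t
  note c = substitution_comp[OF assms(1,2)]
  define i j :: int where "i = min t 0" and "j = max (t + 1) 0"
  have ij: "i \<le> j" "cut (\<sigma> \<circ> \<tau>) y i \<le> t" "t < cut (\<sigma> \<circ> \<tau>) y j"
    using cut_bounds[OF c assms(3), of t] by (auto simp: i_def j_def)
  have "cut \<tau> y i \<le> cut \<tau> y j" using cut_diff_ge[OF assms(1,3) ij(1)] ij(1) by linarith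
  then have "subst_seq \<sigma> (subst_seq \<tau> y) t =
    \<sigma> (factor (subst_seq \<tau> y) (cut \<tau> y i) (cut \<tau> y j)) ! nat (t - cut (\<sigma> \<circ> \<tau>) y i)"
    using subst_seq_nth[OF assms(2) range_subst_seq[OF assms(1,3)], of "cut \<tau> y i" "cut \<tau> y j" t]
      cut_comp[OF assms] ij by simp
  then show "subst_seq (\<sigma> \<circ> \<tau>) y t = subst_seq \<sigma> (subst_seq \<tau> y) t"
    using subst_seq_nth[OF c assms(3) ij] factor_subst_seq[OF assms(1,3) ij(1)] by simp
qed

lemma subst_seq_shift:
  assumes "substitution A B \<sigma>" "range y \<subseteq> A"
  shows "subst_seq \<sigma> ((shift ^^ m) y) = (shift ^^ length (\<sigma> (factor y 0 (int m)))) (subst_seq \<sigma> y)"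
proof
  fix t
  let ?z = "(shift ^^ m) y"
  have z: "range ?z \<subseteq> A" using assms(2) by (auto simp: shift_funpow)
  have fz: "factor ?z i j = factor y (i + m) (j + m)" for i j
    by (simp add: shift_funpow factor_translate)
  have m: "cut \<sigma> y (int m) = int (length (\<sigma> (factor y 0 (int m))))" by (simp add: cut_def)
  have cz: "cut \<sigma> ?z i = cut \<sigma> y (i + m) - cut \<sigma> y m" for i
  proof (cases "0 \<le> i")
    case True
    then show ?thesis using cut_diff[OF assms, of m "i + m"] by (simp add: cut_def[of _ ?z] fz)
  next
    case False
    then show ?thesis using cut_diff[OF assms, of "i + m" m] by (simp add: cut_def[of _ ?z] fz)
  qed
  define i j :: int where "i = min t 0" and "j = max (t + 1) 0"
  have ij: "i \<le> j" "cut \<sigma> ?z i \<le> t" "t < cut \<sigma> ?z j"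
    using cut_bounds[OF assms(1) z, of t] by (auto simp: i_def j_def)
  have "subst_seq \<sigma> ?z t = \<sigma> (factor y (i + m) (j + m)) ! nat (t + cut \<sigma> y m - cut \<sigma> y (i + m))"
    using subst_seq_nth[OF assms(1) z ij] by (simp add: fz cz algebra_simps)
  also have "\<dots> = subst_seq \<sigma> y (t + cut \<sigma> y m)"
    by (rule subst_seq_nth[OF assms, symmetric]) (use ij cz in auto)
  finally show "subst_seq \<sigma> ?z t = (shift ^^ length (\<sigma> (factor y 0 (int m)))) (subst_seq \<sigma> y) t"
    by (simp add: shift_funpow m)
qed

lemma subst_seq_cong:
  assumes "\<And>i. i \<in> {- \<bar>t\<bar>..\<bar>t\<bar>} \<Longrightarrow> y i = z i"
  shows "subst_seq \<sigma> y t = subst_seq \<sigma> z t"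
proof -
  have "factor y 0 (t + 1) = factor z 0 (t + 1)" if "0 \<le> t" by (rule factor_cong) (use assms that in auto)
  moreover have "factor y t 0 = factor z t 0" if "\<not> 0 \<le> t" by (rule factor_cong) (use assms that in auto)
  ultimately show ?thesis by (simp add: subst_seq_def)
qed

text \<open>
  Applied to \<open>\<tau>\<^sub>n(a)\<close> this finds the tower of level \<open>n\<close> that contains a given floor of level \<open>n + 1\<close>; applied to a long word
  it finds the letter whose image covers the origin of a sequence.
\<close>

lemma locate_letter:
  assumes "substitution A B \<sigma>"
  shows "w \<in> lists A \<Longrightarrow> t < length (\<sigma> w) \<Longrightarrow>
    \<exists>u b v. w = u @ [b] @ v \<and> length (\<sigma> u) \<le> t \<and> t < length (\<sigma> u) + length (\<sigma> [b])"
proof (induction w rule: rev_induct)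
  case Nil
  then show ?case by (simp add: substitution_Nil[OF assms])
next
  case (snoc b w)
  have eq: "\<sigma> (w @ [b]) = \<sigma> w @ \<sigma> [b]" using substitution_append[OF assms] snoc.prems by simp
  show ?case
  proof (cases "t < length (\<sigma> w)")
    case True
    then obtain u b' v where "w = u @ [b'] @ v" "length (\<sigma> u) \<le> t" "t < length (\<sigma> u) + length (\<sigma> [b'])"
      using snoc by auto
    then show ?thesis by (intro exI[of _ u] exI[of _ b'] exI[of _ "v @ [b]"]) simp
  next
    case False
    then show ?thesis using snoc.prems eq by (intro exI[of _ w] exI[of _ b] exI[of _ "[]"]) simp
  qed
qed

section \<open>The topology of shift spaces\<close>

lemma topspace_full_shift: "x \<in> topspace (full_shift C) \<longleftrightarrow> range x \<subseteq> C"
  by (auto simp: full_shift_def)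

lemma openin_cylinder:
  assumes "range x \<subseteq> C"
  shows "openin (full_shift C) {z. range z \<subseteq> C \<and> (\<forall>i\<in>{-j..j}. z i = x i)}"
proof -
  have eq: "{z. range z \<subseteq> C \<and> (\<forall>i\<in>{-j..j}. z i = x i)} = PiE UNIV (\<lambda>i. if i \<in> {-j..j} then {x i} else C)"
    (is "?L = ?R")
  proof (intro equalityI subsetI)
    fix z assume "z \<in> ?L"
    then show "z \<in> ?R" by (auto simp: PiE_def Pi_def)
  next
    fix z assume z: "z \<in> ?R"
    have "z i \<in> (if i \<in> {-j..j} then {x i} else C)" for i using PiE_mem[OF z, of i] by simp
    then have "z i \<in> C" "i \<in> {-j..j} \<Longrightarrow> z i = x i" for i
      using assms by (metis range_subsetD singletonD, metis singletonD)
    then show "z \<in> ?L" by blast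
  qed
  show ?thesis unfolding eq full_shift_def
  proof (subst openin_PiE_gen, intro disjI2 conjI ballI)
    show "finite {i \<in> UNIV. (if i \<in> {-j..j} then {x i} else C) \<noteq> topspace (discrete_topology C)}"
      by (rule finite_subset[of _ "{-j..j}"]) auto
    fix i show "openin (discrete_topology C) (if i \<in> {-j..j} then {x i} else C)"
      using assms by auto
  qed
qed

text \<open>
  Compactness of the full shift, in the form in which it is used below: the closures of the tails of the sequence are nested and
  non-empty, and a common point is a cluster point.
\<close>

lemma cluster_sequence:
  fixes f :: "nat \<Rightarrow> int \<Rightarrow> 'b"
  assumes "finite C" and f: "\<And>L. range (f L) \<subseteq> C"
  shows "\<exists>y. range y \<subseteq> C \<and> (\<forall>N j. \<exists>L\<ge>N. \<forall>i\<in>{-j..j}. f L i = y i)"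
proof -
  define T where "T = full_shift C"
  define K where "K N = T closure_of (f ` {N..})" for N
  have fT: "f L \<in> topspace T" for L using f[of L] by (simp add: T_def topspace_full_shift)
  have "compact_space T"
    unfolding T_def full_shift_def
    by (simp add: compact_space_product_topology compact_space_discrete_topology assms(1))
  moreover have "closedin T (K n)" for n by (simp add: K_def)
  moreover have "K n \<noteq> {}" for n
  proof -
    have "f n \<in> K n" unfolding K_def
      using closure_of_subset[of "f ` {n..}" T] fT by auto
    then show ?thesis by auto
  qed
  moreover have "decseq K"
    unfolding decseq_def K_def by (intro allI impI closure_of_mono image_mono) simp
  ultimately have "(\<Inter>n. K n) \<noteq> {}" by (rule compact_space_imp_nest)
  then obtain y where y: "\<And>n. y \<in> K n" by auto
  have "y \<in> topspace T" using y[of 0] closure_of_subset_topspace[of T] unfolding K_def by blast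
  then have yC: "range y \<subseteq> C" by (simp add: T_def topspace_full_shift)
  have "\<exists>L\<ge>N. \<forall>i\<in>{-j..j}. f L i = y i" for N and j :: int
  proof -
    define U where "U = {z. range z \<subseteq> C \<and> (\<forall>i\<in>{-j..j}. z i = y i)}"
    have "openin T U" "y \<in> U" using openin_cylinder[OF yC] yC by (auto simp: U_def T_def)
    then obtain z where "z \<in> f ` {N..}" "z \<in> U"
      using y[of N] unfolding K_def in_closure_of by blast
    then show ?thesis by (auto simp: U_def)
  qed
  then show ?thesis using yC by blast
qed

text \<open>
  \<open>G\<close> is real-valued and is controlled only modulo \<open>1\<close>; it may well be discontinuous as a real function. An open set
  of the circle is the same thing as an open set of reals invariant under integer translations, so the integer by which \<open>G\<close> jumps is harmless.
\<close>

lemma continuous_circleI: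
  assumes X: "\<And>x. x \<in> X \<Longrightarrow> range x \<subseteq> C"
    and loc: "\<And>x e. x \<in> X \<Longrightarrow> 0 < e \<Longrightarrow>
      \<exists>L::nat. \<forall>x'\<in>X. (\<forall>i\<in>{- int L..int L}. x' i = x i) \<longrightarrow> int_dist (G x' - G x) < e"
  shows "continuous_map (subtopology (full_shift C) X) euclidean (\<lambda>x. to_circle (G x))"
  unfolding continuous_map_def
proof (intro conjI allI impI)
  fix U :: "circle set"
  assume "openin euclidean U"
  then have V: "open (to_circle -` U)" by (simp add: open_circle_def)
  have top: "topspace (subtopology (full_shift C) X) = X"
    using X topspace_full_shift[of _ C] by auto
  show "openin (subtopology (full_shift C) X)
      {x \<in> topspace (subtopology (full_shift C) X). to_circle (G x) \<in> U}"
    unfolding top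
  proof (subst openin_subopen, intro ballI)
    fix x assume x: "x \<in> {x \<in> X. to_circle (G x) \<in> U}"
    then have "G x \<in> to_circle -` U" by simp
    then obtain e where e: "0 < e" "ball (G x) e \<subseteq> to_circle -` U"
      using V open_contains_ball by blast
    obtain L :: nat where L: "\<And>x'. x' \<in> X \<Longrightarrow> (\<forall>i\<in>{- int L..int L}. x' i = x i) \<Longrightarrow> int_dist (G x' - G x) < e"
      using loc[of x e] x e(1) by blast
    define T where "T = {z. range z \<subseteq> C \<and> (\<forall>i\<in>{- int L..int L}. z i = x i)} \<inter> X"
    have "openin (subtopology (full_shift C) X) T"
      unfolding T_def using X[of x] x by (intro openin_subtopology_Int openin_cylinder) auto
    moreover have "x \<in> T" using x X[of x] by (simp add: T_def)
    moreover have "to_circle (G x') \<in> U" if "x' \<in> T" for x'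
    proof -
      have "int_dist (G x' - G x) < e" using that by (intro L) (auto simp: T_def)
      then obtain k :: int where "\<bar>G x' - G x - of_int k\<bar> < e" using int_dist_attained by metis
      then have "G x' - of_int k \<in> ball (G x) e" by (simp add: dist_real_def)
      then have "to_circle (G x' - of_int k) \<in> U" using e(2) by blast
      moreover have "to_circle (G x' - of_int k) = to_circle (G x')" by (simp add: to_circle_eq_iff)
      ultimately show ?thesis by simp
    qed
    ultimately show "\<exists>T. openin (subtopology (full_shift C) X) T \<and> x \<in> T \<and> T \<subseteq> {x \<in> X. to_circle (G x) \<in> U}"
      by (intro exI[of _ T]) (auto simp: T_def)
  qed
qed simp

text \<open>
  The arcs around \<open>g x\<close> are open in the quotient topology because their preimages in the real line are, and a basic
  open set of the product topology restricts only finitely many coordinates.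
\<close>

lemma continuous_circleD:
  assumes g: "continuous_map (subtopology (full_shift C) X) euclidean g"
    and X: "\<And>x. x \<in> X \<Longrightarrow> range x \<subseteq> C" and x: "x \<in> X" and e: "0 < e"
  shows "\<exists>L::nat. \<forall>x'\<in>X. (\<forall>i\<in>{- int L..int L}. x' i = x i) \<longrightarrow>
    int_dist (rep_circle (g x') - rep_circle (g x)) < e"
proof -
  define U where "U = {q. int_dist (rep_circle q - rep_circle (g x)) < e}"
  have "to_circle -` U = {s. int_dist (s - rep_circle (g x)) < e}"
  proof -
    have "int_dist (rep_circle (to_circle s) - rep_circle (g x)) = int_dist (s - rep_circle (g x))" for s
      by (rule int_dist_cong) (use rep_to_circle[of s] in simp)
    then show ?thesis by (simp add: U_def)
  qed
  then have "open U" by (simp add: open_circle_def open_int_dist_less)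
  then have "openin (subtopology (full_shift C) X) {z \<in> topspace (subtopology (full_shift C) X). g z \<in> U}"
    using g by (simp add: continuous_map_def)
  moreover have "topspace (subtopology (full_shift C) X) = X"
    using X topspace_full_shift[of _ C] by auto
  ultimately obtain V where V: "openin (full_shift C) V" "{z \<in> X. g z \<in> U} = V \<inter> X"
    unfolding openin_subtopology by auto
  have "int_dist (rep_circle (g x) - rep_circle (g x)) = 0" by (simp add: int_dist_eq_0)
  then have "x \<in> {z \<in> X. g z \<in> U}" using x e by (simp add: U_def)
  then have "x \<in> V" using V(2) by blast
  then obtain W where "finite {i \<in> UNIV. W i \<noteq> topspace (discrete_topology C)}"
    and W': "x \<in> PiE UNIV W" "PiE UNIV W \<subseteq> V"
    using V(1) unfolding full_shift_def openin_product_topology_alt by meson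
  then have W: "finite {i. W i \<noteq> C}" "x \<in> PiE UNIV W" "PiE UNIV W \<subseteq> V" by simp_all
  define L where "L = nat (Max (insert 0 (abs ` {i. W i \<noteq> C})))"
  have L: "i \<in> {- int L..int L}" if "W i \<noteq> C" for i
  proof -
    have "\<bar>i\<bar> \<le> Max (insert 0 (abs ` {i. W i \<noteq> C}))"
      by (rule Max_ge) (use that W(1) in simp_all)
    then show ?thesis by (auto simp: L_def)
  qed
  have "g x' \<in> U" if x': "x' \<in> X" "\<forall>i\<in>{- int L..int L}. x' i = x i" for x'
  proof -
    have "x' i \<in> W i" for i
    proof (cases "W i = C")
      case True
      then show ?thesis using X[OF x'(1)] by auto
    next
      case False
      then have "x' i = x i" using L x'(2) by blast
      then show ?thesis using PiE_mem[OF W(2), of i] by simp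
    qed
    then have "x' \<in> V" using W(3) by auto
    then show ?thesis using V(2) x'(1) by blast
  qed
  then show ?thesis unfolding U_def by blast
qed

section \<open>Uniform limits modulo one\<close>

text \<open>
  A Weierstrass test modulo \<open>1\<close>: subtracting from each increment its nearest integer turns the sequence into the partial sums of
  an absolutely convergent series without changing any value modulo \<open>1\<close>.
\<close>

lemma uniform_limit_mod_1:
  fixes F :: "nat \<Rightarrow> 'x \<Rightarrow> real"
  assumes E: "summable E" and F: "\<And>n x. x \<in> X \<Longrightarrow> int_dist (F (Suc n) x - F n x) \<le> E n"
  shows "\<exists>G. \<forall>n. \<forall>x\<in>X. int_dist (G x - F n x) \<le> (\<Sum>i. E (i + n))"
proof -
  obtain m :: "real \<Rightarrow> int" where m: "\<And>t. int_dist t = \<bar>t - of_int (m t)\<bar>" using int_dist_attained by metis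
  define D where "D n x = F (Suc n) x - F n x - of_int (m (F (Suc n) x - F n x))" for n x
  have D: "\<bar>D n x\<bar> \<le> E n" if "x \<in> X" for n x using F[OF that, of n] m by (simp add: D_def)
  define G where "G x = F 0 x + (\<Sum>i. D i x)" for x
  have "int_dist (G x - F n x) \<le> (\<Sum>i. E (i + n))" if x: "x \<in> X" for n x
  proof -
    have sD: "summable (\<lambda>i. D i x)" using summable_rabs_comparison_test[OF _ E] D[OF x]
      by (metis summable_rabs_cancel)
    have "F 0 x + (\<Sum>i<n. D i x) - F n x \<in> \<int>"
    proof (induction n)
      case (Suc n)
      have "F 0 x + (\<Sum>i<Suc n. D i x) - F (Suc n) x =
        (F 0 x + (\<Sum>i<n. D i x) - F n x) - of_int (m (F (Suc n) x - F n x))" by (simp add: D_def)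
      then show ?case using Suc by (metis Ints_diff Ints_of_int)
    qed simp
    moreover have "G x = F 0 x + (\<Sum>i<n. D i x) + (\<Sum>i. D (i + n) x)"
      using suminf_split_initial_segment[OF sD, of n] by (simp add: G_def)
    ultimately have "int_dist (G x - F n x) = int_dist (\<Sum>i. D (i + n) x)"
      by (intro int_dist_cong) (simp add: algebra_simps)
    also have "\<dots> \<le> \<bar>\<Sum>i. D (i + n) x\<bar>" by (rule int_dist_le_abs)
    also have "\<dots> \<le> (\<Sum>i. E (i + n))"
    proof -
      have s: "summable (\<lambda>i. E (i + n))" using E summable_iff_shift by blast
      have sa: "summable (\<lambda>i. \<bar>D (i + n) x\<bar>)"
        by (rule summable_comparison_test'[OF s]) (simp add: D[OF x])
      show ?thesis using summable_rabs[OF sa] suminf_le[OF D[OF x] sa s] by linarith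
    qed
    finally show ?thesis .
  qed
  then show ?thesis by blast
qed

lemma tail_sum_tendsto_0:
  fixes E :: "nat \<Rightarrow> real"
  assumes "summable E"
  shows "(\<lambda>n. \<Sum>i. E (i + n)) \<longlonglongrightarrow> 0"
proof -
  have "(\<lambda>n. suminf E - (\<Sum>i<n. E i)) \<longlonglongrightarrow> suminf E - suminf E"
    by (intro tendsto_intros summable_LIMSEQ assms)
  then show ?thesis using suminf_minus_initial_segment[OF assms] by simp
qed

section \<open>The subshifts of a directive sequence\<close>

locale directive =
  fixes A :: "nat \<Rightarrow> 'a set" and \<tau> :: "nat \<Rightarrow> 'a list \<Rightarrow> 'a list"
  assumes directive: "directive_sequence A \<tau>"
begin

abbreviation level where "level n \<equiv> level_shift A \<tau> n"

lemma finite_A: "finite (A n)"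
  using directive by (simp add: directive_sequence_def alphabet_def)

lemma A_nonempty: "A n \<noteq> {}"
proof -
  have "2 \<le> card (A n)" using directive by (simp add: directive_sequence_def alphabet_def)
  then show ?thesis by auto
qed

lemma subst_step: "substitution (A (Suc n)) (A n) (\<tau> n)"
  using directive by (simp add: directive_sequence_def)

lemma comp_subst_refl: "comp_subst \<tau> n n = id"
  by (cases n) auto

lemma subst_comp: "n \<le> m \<Longrightarrow> substitution (A m) (A n) (comp_subst \<tau> n m)"
proof (induction m rule: dec_induct)
  case base
  show ?case unfolding comp_subst_refl by (rule substitution_id)
next
  case (step m)
  have "comp_subst \<tau> n (Suc m) = comp_subst \<tau> n m \<circ> \<tau> m" using step(1) by simp
  then show ?case using substitution_comp[OF subst_step step(3)] by metis
qed

lemma comp_subst_trans: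
  "m \<le> p \<Longrightarrow> n \<le> m \<Longrightarrow> comp_subst \<tau> n p = comp_subst \<tau> n m \<circ> comp_subst \<tau> m p"
  by (induction p rule: dec_induct) (auto simp: comp_subst_refl comp_assoc)

lemma height_append: "u \<in> lists (A n) \<Longrightarrow> v \<in> lists (A n) \<Longrightarrow>
    height \<tau> n (u @ v) = height \<tau> n u + height \<tau> n v"
  using substitution_append[OF subst_comp[of 0 n]] by (simp add: height_def)

lemma height_pos: "a \<in> A n \<Longrightarrow> 0 < height \<tau> n [a]"
  using substitution_nonempty[OF subst_comp[of 0 n]] by (simp add: height_def)

lemma level_range: "y \<in> level n \<Longrightarrow> range y \<subseteq> A n"
  by (simp add: level_shift_def)

lemma level_letter: "y \<in> level n \<Longrightarrow> y i \<in> A n"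
  using level_range by blast

lemma level_translate: "y \<in> level n \<Longrightarrow> (\<lambda>k. y (k + i)) \<in> level n"
  by (auto simp: level_shift_def factor_translate)

lemma level_funpow: "y \<in> level n \<Longrightarrow> (shift ^^ k) y \<in> level n"
  unfolding shift_funpow by (rule level_translate)

lemma level_shift_closed: "y \<in> level n \<Longrightarrow> shift y \<in> level n"
  using level_funpow[of y n 1] by simp

lemma level_image:
  assumes "n \<le> m" "y \<in> level m"
  shows "subst_seq (comp_subst \<tau> n m) y \<in> level n"
proof -
  let ?s = "comp_subst \<tau> n m"
  note s = subst_comp[OF assms(1)] and r = level_range[OF assms(2)]
  have "\<exists>k>n. \<exists>a\<in>A k. sublist (factor (subst_seq ?s y) i j) (comp_subst \<tau> n k [a])" for i j
  proof -
    define p q where "p = min i 0" and "q = max j 0"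
    have pq: "p \<le> q" by (simp add: p_def q_def)
    have "cut ?s y p \<le> i" "j \<le> cut ?s y q"
      using cut_diff_ge[OF s r, of p 0] cut_diff_ge[OF s r, of 0 q] cut_0[OF s, of y]
      by (auto simp: p_def q_def)
    then have 1: "sublist (factor (subst_seq ?s y) i j) (?s (factor y p q))"
      using sublist_factor[of "cut ?s y p" i j "cut ?s y q" "subst_seq ?s y"] factor_subst_seq[OF s r pq] by simp
    obtain k a where k: "k > m" "a \<in> A k" "sublist (factor y p q) (comp_subst \<tau> m k [a])"
      using assms(2) unfolding level_shift_def by blast
    have "sublist (?s (factor y p q)) (?s (comp_subst \<tau> m k [a]))"
      using substitution_sublist[OF s _ k(3)] substitution_lists[OF subst_comp[of m k], of "[a]"] k by simp
    then have "sublist (?s (factor y p q)) (comp_subst \<tau> n k [a])"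
      using comp_subst_trans[of m k n] k assms by simp
    with 1 have "sublist (factor (subst_seq ?s y) i j) (comp_subst \<tau> n k [a])"
      by (rule sublist_order.order_trans)
    moreover have "n < k" using k(1) assms(1) by simp
    ultimately show ?thesis using k(2) by blast
  qed
  then show ?thesis using range_subst_seq[OF s r] by (simp add: level_shift_def)
qed

lemma language_iff: "u \<in> language (level n) \<longleftrightarrow> (\<exists>y\<in>level n. u = factor y 0 (int (length u)))"
proof
  assume "u \<in> language (level n)"
  then obtain x i j where x: "x \<in> level n" "u = factor x i j" by (auto simp: language_def)
  then have "u = factor (\<lambda>k. x (k + i)) 0 (int (length u))"
    unfolding factor_translate by (cases "i \<le> j") simp_all
  then show "\<exists>y\<in>level n. u = factor y 0 (int (length u))" using level_translate[OF x(1)] by blast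
next
  assume "\<exists>y\<in>level n. u = factor y 0 (int (length u))"
  then show "u \<in> language (level n)" unfolding language_def by blast
qed

lemma language_pair_iff: "[a, b] \<in> language (level n) \<longleftrightarrow> (\<exists>y\<in>level n. y 0 = a \<and> y 1 = b)"
proof -
  have "factor y 0 (int (length [a, b])) = [y 0, y 1]" for y :: "int \<Rightarrow> 'a"
    using factor_append[of 0 1 2 y] factor_single[of y 0] factor_single[of y 1] by simp
  then show ?thesis unfolding language_iff by (metis list.inject)
qed

lemma language_letter_iff: "[a] \<in> language (level n) \<longleftrightarrow> (\<exists>y\<in>level n. y 0 = a)"
proof -
  have "factor y 0 (int (length [a])) = [y 0]" for y :: "int \<Rightarrow> 'a" using factor_single[of y 0] by simp
  then show ?thesis unfolding language_iff by (metis list.inject)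
qed

lemma factor_in_language: "y \<in> level n \<Longrightarrow> factor y i j \<in> language (level n)"
  by (auto simp: language_def)

lemma language_lists: "u \<in> language (level n) \<Longrightarrow> u \<in> lists (A n)"
  unfolding language_def using factor_in_lists[OF level_range] by (elim CollectE exE conjE) metis

lemma language_sublist:
  assumes "u \<in> language (level n)" "sublist v u"
  shows "v \<in> language (level n)"
proof -
  obtain p s where u: "u = p @ v @ s" using assms(2) by (auto simp: sublist_def)
  obtain y where y: "y \<in> level n" "u = factor y 0 (int (length u))" using assms(1) language_iff by blast
  have "v = factor y (int (length p)) (int (length p) + int (length v))"
  proof (rule nth_equalityI)
    fix i assume i: "i < length v"
    then have "v ! i = u ! (length p + i)" by (simp add: u nth_append)
    also have "\<dots> = factor y 0 (int (length u)) ! (length p + i)" using y(2) by metis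
    also have "\<dots> = y (int (length p + i))" using i by (subst nth_factor) (simp_all add: u)
    finally show "v ! i = factor y (int (length p)) (int (length p) + int (length v)) ! i"
      using i by (simp add: nth_factor)
  qed simp
  then show ?thesis using factor_in_language[OF y(1)] by metis
qed

lemma language_image:
  assumes "n \<le> m" "u \<in> language (level m)"
  shows "comp_subst \<tau> n m u \<in> language (level n)"
proof -
  obtain y where y: "y \<in> level m" "u = factor y 0 (int (length u))" using assms(2) language_iff by blast
  show ?thesis
    using factor_subst_seq[OF subst_comp[OF assms(1)] level_range[OF y(1)], of 0 "int (length u)"] y(2)
      factor_in_language[OF level_image[OF assms(1) y(1)]] by (metis of_nat_0_le_iff)
qed

text \<open>
  The level that witnesses a word of the subshift can be raised, since each letter occurs in the image of some letter of any higher level.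
  Desubstitution to level \<open>n\<close> needs witnesses above \<open>n\<close>.
\<close>

lemma level_sublist_high:
  assumes "x \<in> level p"
  shows "\<exists>m>N. m > p \<and> (\<exists>a\<in>A m. sublist (factor x i j) (comp_subst \<tau> p m [a]))"
proof -
  obtain m a where m: "m > p" "a \<in> A m" "sublist (factor x i j) (comp_subst \<tau> p m [a])"
    using assms unfolding level_shift_def by fast
  define M where "M = Suc (max m N)"
  have M: "m \<le> M" "N < M" by (auto simp: M_def)
  obtain b where b: "b \<in> A M" "a \<in> set (comp_subst \<tau> m M [b])"
    using substitution_onto[OF subst_comp[OF M(1)] m(2)] by blast
  have "sublist [a] (comp_subst \<tau> m M [b])" using split_list[OF b(2)] by (auto simp: sublist_def)
  then have "sublist (comp_subst \<tau> p m [a]) (comp_subst \<tau> p m (comp_subst \<tau> m M [b]))"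
    using substitution_sublist[OF subst_comp[of p m]] substitution_lists[OF subst_comp[OF M(1)], of "[b]"] b m
    by simp
  then have "sublist (comp_subst \<tau> p m [a]) (comp_subst \<tau> p M [b])"
    using m(1) comp_subst_trans[of m M p] M by simp
  then have "sublist (factor x i j) (comp_subst \<tau> p M [b])"
    using m(3) sublist_order.order_trans by blast
  then show ?thesis using M m b by (meson less_le_trans)
qed

section \<open>Desubstitution\<close>

text \<open>
  The common compactness argument for covering and openness. The \<open>Y L\<close> are approximate desubstitutions of \<open>x\<close>: their images, shifted by
  \<open>K L\<close>, agree with \<open>x\<close> on growing windows. A cluster point of the \<open>Y L\<close> is an exact one. The last clause says
  that the offset and the central letter of the limit are attained by infinitely many approximations, which is what openness needs.
\<close>

lemma tower_limit:
  assumes Y: "\<And>L. range (Y L) \<subseteq> A n" and K: "\<And>L. K L < height \<tau> n [Y L 0]"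
    and x: "\<And>L i. i \<in> {- int L..int L} \<Longrightarrow> subst_seq (comp_subst \<tau> 0 n) (Y L) (i + int (K L)) = x i"
    and fac: "\<And>L. \<exists>m>n. \<exists>a\<in>A m. sublist (factor (Y L) (- int L) (int L + 1)) (comp_subst \<tau> n m [a])"
  shows "\<exists>y\<in>level n. \<exists>k<height \<tau> n [y 0]. x = (shift ^^ k) (subst_seq (comp_subst \<tau> 0 n) y) \<and>
    (\<forall>N. \<exists>L\<ge>N. K L = k \<and> Y L 0 = y 0)"
proof -
  let ?s = "comp_subst \<tau> 0 n"
  define H where "H = Max ((\<lambda>a. height \<tau> n [a]) ` A n)"
  have H: "height \<tau> n [a] \<le> H" if "a \<in> A n" for a
    unfolding H_def using that finite_A by auto
  \<comment> \<open>Carrying the offset as a second component makes it converge together with the sequence.\<close>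
  define f where "f L i = (Y L i, K L)" for L and i :: int
  have "\<exists>z. range z \<subseteq> A n \<times> {..<H} \<and> (\<forall>N j. \<exists>L\<ge>N. \<forall>i\<in>{-j..j}. f L i = z i)"
  proof (rule cluster_sequence)
    show "finite (A n \<times> {..<H})" using finite_A by simp
    show "range (f L) \<subseteq> A n \<times> {..<H}" for L
      using Y[of L] K[of L] H[of "Y L 0"] by (force simp: f_def)
  qed
  then obtain z where z: "range z \<subseteq> A n \<times> {..<H}" "\<And>N j. \<exists>L\<ge>N. \<forall>i\<in>{-j..j}. f L i = z i" by blast
  define y where "y = (\<lambda>i. fst (z i))"
  define k where "k = snd (z 0)"
  have agree: "\<exists>L\<ge>N. K L = k \<and> (\<forall>i\<in>{-j..j}. Y L i = y i)" if "0 \<le> j" for N j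
  proof -
    obtain L where L: "L \<ge> N" "\<forall>i\<in>{-j..j}. f L i = z i" using z(2) by blast
    then have "f L 0 = z 0" using that by auto
    then have "K L = k" by (simp add: f_def k_def) (metis snd_conv)
    moreover have "Y L i = y i" if "i \<in> {-j..j}" for i
      using bspec[OF L(2) that] by (simp add: f_def y_def) (metis fst_conv)
    ultimately show ?thesis using L(1) by blast
  qed
  have "range y \<subseteq> A n"
  proof
    fix a assume "a \<in> range y"
    then obtain i where "a = fst (z i)" by (auto simp: y_def)
    moreover have "z i \<in> A n \<times> {..<H}" using z(1) by blast
    ultimately show "a \<in> A n" by auto
  qed
  moreover have "\<exists>m>n. \<exists>a\<in>A m. sublist (factor y i j) (comp_subst \<tau> n m [a])" for i j
  proof -
    define J where "J = max \<bar>i\<bar> \<bar>j\<bar>"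
    have J: "0 \<le> J" by (simp add: J_def)
    obtain L where L: "L \<ge> nat J" "\<forall>i\<in>{-J..J}. Y L i = y i" using agree[of J "nat J"] J by blast
    have "factor y i j = factor (Y L) i j"
    proof (rule factor_cong)
      fix k assume "i \<le> k" "k < j"
      then have "k \<in> {-J..J}" by (auto simp: J_def)
      then show "y k = Y L k" using L(2) by simp
    qed
    moreover have "sublist (factor (Y L) i j) (factor (Y L) (- int L) (int L + 1))"
      by (rule sublist_factor) (use L(1) in \<open>auto simp: J_def\<close>)
    moreover obtain m a where m: "m > n" "a \<in> A m"
      "sublist (factor (Y L) (- int L) (int L + 1)) (comp_subst \<tau> n m [a])" using fac[of L] by meson
    ultimately have "sublist (factor y i j) (comp_subst \<tau> n m [a])"
      by (metis sublist_order.order_trans)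
    then show ?thesis using m by blast
  qed
  ultimately have yX: "y \<in> level n" by (simp add: level_shift_def)
  have kh: "k < height \<tau> n [y 0]"
  proof -
    obtain L where L: "K L = k" "\<forall>i\<in>{-0..0::int}. Y L i = y i" using agree[of 0 0] by blast
    then have "Y L 0 = y 0" by simp
    then show ?thesis using K[of L] L(1) by simp
  qed
  have "x = (shift ^^ k) (subst_seq ?s y)"
  proof
    fix i
    define J where "J = \<bar>i + int k\<bar>"
    have J: "0 \<le> J" by (simp add: J_def)
    obtain L where L: "L \<ge> nat \<bar>i\<bar>" "K L = k" "\<forall>i\<in>{-J..J}. Y L i = y i"
      using agree[of J "nat \<bar>i\<bar>"] J by blast
    have "i \<in> {- int L..int L}" using L(1) by auto
    then have "x i = subst_seq ?s (Y L) (i + int k)" using x[of i L] L(2) by simp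
    also have "\<dots> = subst_seq ?s y (i + int k)" by (rule subst_seq_cong) (use L in \<open>auto simp: J_def\<close>)
    finally show "x i = (shift ^^ k) (subst_seq ?s y) i" by (simp add: shift_funpow)
  qed
  moreover have "\<forall>N. \<exists>L\<ge>N. K L = k \<and> Y L 0 = y 0"
  proof
    fix N
    obtain L where L: "L \<ge> N" "K L = k" "\<forall>i\<in>{-0..0::int}. Y L i = y i" using agree[of 0 N] by blast
    then have "Y L 0 = y 0" by simp
    then show "\<exists>L\<ge>N. K L = k \<and> Y L 0 = y 0" using L by blast
  qed
  ultimately show ?thesis using yX kh by blast
qed

text \<open>
  A long central window of \<open>x\<close> occurs in some \<open>\<tau>\<^sub>0 \<dots> \<tau>\<^sub>n\<^sub>-\<^sub>1(w)\<close> with \<open>w = \<tau>\<^sub>n \<dots> \<tau>\<^sub>m\<^sub>-\<^sub>1(a)\<close>. The sequence \<open>y\<close> is the word \<open>w\<close>,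
  centred at the letter whose image contains coordinate \<open>0\<close> of \<open>x\<close> and continued by a constant letter. The window is long
  enough that the central part of \<open>y\<close> is read off \<open>w\<close>.
\<close>

lemma desubstitute_window:
  assumes "x \<in> level 0"
  shows "\<exists>y k. range y \<subseteq> A n \<and> k < height \<tau> n [y 0] \<and>
    (\<forall>i\<in>{- int L..int L}. subst_seq (comp_subst \<tau> 0 n) y (i + int k) = x i) \<and>
    (\<exists>m>n. \<exists>a\<in>A m. sublist (factor y (- int L) (int L + 1)) (comp_subst \<tau> n m [a]))"
proof -
  let ?s = "comp_subst \<tau> 0 n"
  note s = subst_comp[of 0 n, simplified]
  define H where "H = Max ((\<lambda>a. height \<tau> n [a]) ` A n)"
  have H: "length (?s [a]) \<le> H" if "a \<in> A n" for a
    unfolding H_def height_def using that finite_A by auto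
  have H0: "0 < H" using A_nonempty[of n] H height_pos by (fastforce simp: height_def)
  \<comment> \<open>Each letter of \<open>w\<close> covers at most \<open>H\<close> coordinates, so a half-window of \<open>(L + 2) H\<close> covers at least \<open>L + 2\<close> letters.\<close>
  define W where "W = (L + 2) * H"
  have "(L + 2) * 1 \<le> (L + 2) * H" using H0 by (intro mult_le_mono2) simp
  then have LW: "L < W" unfolding W_def by simp
  obtain m a where m: "m > n" "a \<in> A m" and sub: "sublist (factor x (- int W) (int W)) (comp_subst \<tau> 0 m [a])"
    using level_sublist_high[OF assms, of n "- int W" "int W"] by blast
  define w where "w = comp_subst \<tau> n m [a]"
  have w: "w \<in> lists (A n)" using substitution_lists[OF subst_comp[of n m], of "[a]"] m by (simp add: w_def)
  have "comp_subst \<tau> 0 m [a] = ?s w" using comp_subst_trans[of n m 0] m by (simp add: w_def)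
  then obtain pre suf where ps: "?s w = pre @ factor x (- int W) (int W) @ suf"
    using sub by (auto simp: sublist_def)
  define t where "t = length pre + W"
  have len: "length (?s w) = length pre + 2 * W + length suf" unfolding ps by simp
  have "t < length (?s w)" using LW len by (simp add: t_def)
  then obtain u b v where uv: "w = u @ [b] @ v" "length (?s u) \<le> t" "t < length (?s u) + length (?s [b])"
    using locate_letter[OF s w] by blast
  have uA: "u \<in> lists (A n)" "b \<in> A n" "v \<in> lists (A n)" using w uv(1) by auto
  define q where "q = length u"
  define k where "k = t - length (?s u)"
  define y where "y i = (if 0 \<le> i + int q \<and> i + int q < int (length w) then w ! nat (i + int q) else b)" for i
  have ry: "range y \<subseteq> A n" using w uA by (auto simp: y_def)
  have y0: "y 0 = b" by (simp add: y_def uv(1) q_def)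
  define r where "r = int (length w) - int q"
  have r0: "0 \<le> r" by (simp add: r_def q_def uv(1))
  have fw: "factor y (- int q) r = w"
    by (rule nth_equalityI) (auto simp: r_def nth_factor y_def)
  have fu: "factor y (- int q) 0 = u"
    by (rule nth_equalityI) (auto simp: nth_factor y_def q_def uv(1) nth_append)
  have cq: "cut ?s y (- int q) = - int (length (?s u))"
    using cut_diff[OF s ry, of "- int q" 0] cut_0[OF s, of y] by (simp add: fu)
  have cr: "cut ?s y r = int (length (?s w)) - int (length (?s u))"
    using cut_diff[OF s ry, of "- int q" r] r0 by (simp add: fw cq)
  have kt: "int k = int t - int (length (?s u))" using uv(2) by (simp add: k_def)
  have val: "subst_seq ?s y (i + int k) = x i" if i: "i \<in> {- int L..int L}" for i
  proof -
    have iW: "- int W \<le> i" "i < int W" using i LW by auto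
    have "subst_seq ?s y (i + int k) = ?s w ! nat (i + int k - cut ?s y (- int q))"
      using subst_seq_nth[OF s ry, of "- int q" r "i + int k"] iW cq cr kt r0 len by (simp add: fw t_def)
    also have "nat (i + int k - cut ?s y (- int q)) = length pre + nat (i + int W)"
      using iW kt cq by (simp add: t_def)
    also have "?s w ! \<dots> = factor x (- int W) (int W) ! nat (i + int W)"
      unfolding ps using iW by (simp add: nth_append)
    also have "\<dots> = x i" using iW by (subst nth_factor) auto
    finally show ?thesis .
  qed
  have "L + 2 < q + 1"
  proof -
    have "t < H * (q + 1)"
      using uv(3) H[OF uA(2)] length_substitution_le[OF s H uA(1)] by (simp add: q_def)
    then have "H * (L + 2) < H * (q + 1)" by (simp add: t_def W_def mult.commute)
    then show ?thesis using mult_less_cancel1 by blast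
  qed
  moreover have "int L + 2 \<le> r"
  proof -
    have "?s w = ?s u @ ?s ([b] @ v)" using substitution_append[OF s, of u "[b] @ v"] uv(1) uA by simp
    then have "length (?s w) \<le> t + H * (length w - q)"
      using uv(2) length_substitution_le[OF s H, of "[b] @ v"] uA by (simp add: q_def uv(1))
    then have "H * (L + 2) \<le> H * (length w - q)" using len by (simp add: t_def W_def mult.commute)
    then have "L + 2 \<le> length w - q" using H0 mult_le_cancel1 by blast
    then show ?thesis by (simp add: r_def)
  qed
  ultimately have "sublist (factor y (- int L) (int L + 1)) w"
    using sublist_factor[of "- int q" "- int L" "int L + 1" r y] fw by simp
  moreover have "k < height \<tau> n [y 0]" using uv(3) kt by (simp add: height_def y0)
  ultimately show ?thesis using ry val m w_def by blast
qed

lemma desubstitution: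
  assumes "x \<in> level 0"
  shows "\<exists>y\<in>level n. \<exists>k<height \<tau> n [y 0]. x = (shift ^^ k) (subst_seq (comp_subst \<tau> 0 n) y)"
proof -
  define P where "P L y k \<longleftrightarrow> range y \<subseteq> A n \<and> k < height \<tau> n [y 0] \<and>
    (\<forall>i\<in>{- int L..int L}. subst_seq (comp_subst \<tau> 0 n) y (i + int k) = x i) \<and>
    (\<exists>m>n. \<exists>a\<in>A m. sublist (factor y (- int L) (int L + 1)) (comp_subst \<tau> n m [a]))" for L y k
  have "\<forall>L. \<exists>y k. P L y k" unfolding P_def using desubstitute_window[OF assms, of n] by (rule allI)
  then obtain Y K where P: "\<And>L. P L (Y L) (K L)" by metis
  have "\<exists>y\<in>level n. \<exists>k<height \<tau> n [y 0]. x = (shift ^^ k) (subst_seq (comp_subst \<tau> 0 n) y) \<and>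
    (\<forall>N. \<exists>L\<ge>N. K L = k \<and> Y L 0 = y 0)"
    by (rule tower_limit) (use P in \<open>unfold P_def, simp_all\<close>)
  then show ?thesis by blast
qed

text \<open>
  One floor of the tower over \<open>a\<close>; the whole tower is the union over \<open>k < height \<tau> n [a]\<close>.
\<close>

definition tower where "tower n a k = (shift ^^ k) ` base A \<tau> n a"

lemma tower_iff:
  "x \<in> tower n a k \<longleftrightarrow> (\<exists>y\<in>level n. y 0 = a \<and> x = (shift ^^ k) (subst_seq (comp_subst \<tau> 0 n) y))"
  by (auto simp: tower_def base_def)

lemma tower_cover:
  assumes "x \<in> level 0"
  shows "\<exists>a\<in>A n. \<exists>k<height \<tau> n [a]. x \<in> tower n a k"
  using desubstitution[OF assms, of n] level_letter unfolding tower_iff by blast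

text \<open>
  From the top floor the shift leaves the image of \<open>y\<^sub>0 = a\<close> and reaches the image of the shifted sequence, whose central
  letter \<open>y\<^sub>1\<close> follows \<open>a\<close>.
\<close>

lemma tower_shift:
  assumes "x \<in> tower n a k" "k < height \<tau> n [a]"
  shows "Suc k < height \<tau> n [a] \<and> shift x \<in> tower n a (Suc k) \<or>
    Suc k = height \<tau> n [a] \<and> (\<exists>b\<in>A n. [a, b] \<in> language (level n) \<and> shift x \<in> tower n b 0)"
proof -
  let ?s = "comp_subst \<tau> 0 n"
  obtain y where y: "y \<in> level n" "y 0 = a" "x = (shift ^^ k) (subst_seq ?s y)"
    using assms(1) unfolding tower_iff by blast
  have sx: "shift x = (shift ^^ Suc k) (subst_seq ?s y)" by (simp add: y(3))
  show ?thesis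
  proof (cases "Suc k < height \<tau> n [a]")
    case True
    then show ?thesis using y sx unfolding tower_iff by blast
  next
    case False
    then have h: "Suc k = height \<tau> n [a]" using assms(2) by simp
    have "subst_seq ?s (shift y) = (shift ^^ Suc k) (subst_seq ?s y)"
      using subst_seq_shift[OF subst_comp[of 0 n] level_range[OF y(1)], of 1] factor_single[of y 0]
      by (simp add: h height_def y(2))
    then have "shift x \<in> tower n (y 1) 0"
      unfolding tower_iff sx using level_shift_closed[OF y(1)]
      by (intro bexI[of _ "shift y"]) (simp_all add: shift_def)
    moreover have "[a, y 1] \<in> language (level n)" using language_pair_iff y by blast
    ultimately show ?thesis using h level_letter[OF y(1)] by blast
  qed
qed

lemma tower_desubst:
  assumes "n \<le> m" "x \<in> tower m a k"
  shows "\<exists>z\<in>level n. factor z 0 (int (length (comp_subst \<tau> n m [a]))) = comp_subst \<tau> n m [a] \<and>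
    x = (shift ^^ k) (subst_seq (comp_subst \<tau> 0 n) z)"
proof -
  obtain y where y: "y \<in> level m" "y 0 = a" "x = (shift ^^ k) (subst_seq (comp_subst \<tau> 0 m) y)"
    using assms(2) unfolding tower_iff by blast
  note r = level_range[OF y(1)] and t = subst_comp[OF assms(1)]
  define z where "z = subst_seq (comp_subst \<tau> n m) y"
  have "z \<in> level n" unfolding z_def by (rule level_image[OF assms(1) y(1)])
  moreover have "x = (shift ^^ k) (subst_seq (comp_subst \<tau> 0 n) z)"
    using subst_seq_comp[OF t subst_comp[of 0 n] r] comp_subst_trans[OF assms(1), of 0] y(3)
    by (simp add: z_def)
  moreover have "factor z 0 (int (length (comp_subst \<tau> n m [a]))) = comp_subst \<tau> n m [a]"
    using factor_subst_seq[OF t r, of 0 1] factor_single[of y 0] cut_0[OF t, of y]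
    by (simp add: z_def cut_def y(2))
  ultimately show ?thesis by blast
qed

lemma subst_seq_shift_word:
  assumes "z \<in> level n" "factor z 0 (int (length u)) = u"
  shows "subst_seq (comp_subst \<tau> 0 n) ((shift ^^ length u) z) =
    (shift ^^ height \<tau> n u) (subst_seq (comp_subst \<tau> 0 n) z)"
  using subst_seq_shift[OF subst_comp[of 0 n] level_range[OF assms(1)], of "length u"] assms(2)
  by (simp add: height_def)

lemma tower_shift_word:
  assumes "z \<in> level n" "factor z 0 (int (length u)) = u"
  shows "(shift ^^ height \<tau> n u) (subst_seq (comp_subst \<tau> 0 n) z) \<in> tower n (z (int (length u))) 0"
  unfolding tower_iff subst_seq_shift_word[OF assms, symmetric]
  by (intro bexI[of _ "(shift ^^ length u) z"] level_funpow[OF assms(1)]) (simp add: shift_funpow)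

text \<open>
  The tower of \<open>a\<close> at level \<open>n + 1\<close> is a stack of towers of level \<open>n\<close>, one for each letter of \<open>\<tau>\<^sub>n(a)\<close>.
\<close>

lemma tower_descend:
  assumes "x \<in> tower (Suc n) a k" "a \<in> A (Suc n)" "k < height \<tau> (Suc n) [a]"
  shows "\<exists>u b v. \<tau> n [a] = u @ [b] @ v \<and> b \<in> A n \<and> height \<tau> n u \<le> k \<and>
    k - height \<tau> n u < height \<tau> n [b] \<and> x \<in> tower n b (k - height \<tau> n u)"
proof -
  let ?s = "comp_subst \<tau> 0 n"
  obtain z where z: "z \<in> level n" "factor z 0 (int (length (\<tau> n [a]))) = \<tau> n [a]" "x = (shift ^^ k) (subst_seq ?s z)"
    using tower_desubst[of n "Suc n" x a k] assms(1) by (auto simp: comp_subst_refl)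
  have wA: "\<tau> n [a] \<in> lists (A n)" using substitution_lists[OF subst_step, of "[a]" n] assms(2) by simp
  have "k < length (?s (\<tau> n [a]))" using assms(3) by (simp add: height_def)
  then obtain u b v where uv: "\<tau> n [a] = u @ [b] @ v" "length (?s u) \<le> k" "k < length (?s u) + length (?s [b])"
    using locate_letter[OF subst_comp[of 0 n, simplified] wA] by blast
  have fu: "factor z 0 (int (length u)) = u" and zb: "z (int (length u)) = b"
    using factor_prefix[OF z(2) uv(1)] by simp_all
  obtain z' where z': "z' \<in> level n" "z' 0 = b" "(shift ^^ height \<tau> n u) (subst_seq ?s z) = subst_seq ?s z'"
    using tower_shift_word[OF z(1) fu] zb unfolding tower_iff by auto
  have "x = (shift ^^ (k - height \<tau> n u)) ((shift ^^ height \<tau> n u) (subst_seq ?s z))"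
    using uv(2) by (simp add: z(3) height_def shift_funpow)
  then have "x \<in> tower n b (k - height \<tau> n u)"
    unfolding tower_iff using z' by (intro bexI[of _ z']) auto
  moreover have "b \<in> A n" using z'(2) level_letter[OF z'(1), of 0] by simp
  ultimately show ?thesis using uv by (intro exI[of _ u] exI[of _ b] exI[of _ v]) (auto simp: height_def)
qed

end

locale recognizable_directive = directive +
  assumes recog: "recognizable A \<tau>"
begin

lemma tower_unique:
  assumes "1 \<le> n" "x \<in> tower n a k" "x \<in> tower n b l" "a \<in> A n" "b \<in> A n"
    "k < height \<tau> n [a]" "l < height \<tau> n [b]"
  shows "a = b \<and> k = l"
proof (rule ccontr)
  assume ne: "\<not> (a = b \<and> k = l)"
  have "disjoint_family_on (\<lambda>(a, k). (shift ^^ k) ` base A \<tau> n a) {(a, k). a \<in> A n \<and> k < height \<tau> n [a]}"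
    using recog assms(1) by (simp add: recognizable_def)
  from disjoint_family_onD[OF this, of "(a, k)" "(b, l)"] show False
    using ne assms by (auto simp: tower_def)
qed

text \<open>
  If points of other floors came arbitrarily close to \<open>x\<close>, a limit of their desubstitutions would put \<open>x\<close> on
  another floor as well, because infinitely many of them lie on the same floor as the limit.
\<close>

lemma tower_open:
  assumes "1 \<le> n" "x \<in> tower n a k" "a \<in> A n" "k < height \<tau> n [a]"
  shows "\<exists>L::nat. \<forall>x'\<in>level 0. (\<forall>i\<in>{- int L..int L}. x' i = x i) \<longrightarrow> x' \<in> tower n a k"
proof (rule ccontr)
  let ?s = "comp_subst \<tau> 0 n"
  assume "\<not> ?thesis"
  then obtain X' where X': "\<And>L. X' L \<in> level 0" "\<And>L i. i \<in> {- int L..int L} \<Longrightarrow> X' L i = x i"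
    "\<And>L. X' L \<notin> tower n a k" by metis
  have "\<forall>L. \<exists>y k. y \<in> level n \<and> k < height \<tau> n [y 0] \<and> X' L = (shift ^^ k) (subst_seq ?s y)"
    using desubstitution[OF X'(1), of n] by blast
  then obtain Y K where YK: "\<And>L. Y L \<in> level n" "\<And>L. K L < height \<tau> n [Y L 0]"
    "\<And>L. X' L = (shift ^^ K L) (subst_seq ?s (Y L))" by metis
  have "\<exists>y\<in>level n. \<exists>k<height \<tau> n [y 0]. x = (shift ^^ k) (subst_seq ?s y) \<and>
    (\<forall>N. \<exists>L\<ge>N. K L = k \<and> Y L 0 = y 0)"
  proof (rule tower_limit)
    fix L i assume "i \<in> {- int L..int L}"
    then have "x i = X' L i" using X'(2) by simp
    then show "subst_seq ?s (Y L) (i + int (K L)) = x i" by (simp add: YK(3) shift_funpow)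
  next
    fix L
    show "\<exists>m>n. \<exists>a\<in>A m. sublist (factor (Y L) (- int L) (int L + 1)) (comp_subst \<tau> n m [a])"
      using YK(1)[of L] unfolding level_shift_def by blast
  qed (use YK level_range in auto)
  then obtain y l L where y: "y \<in> level n" "l < height \<tau> n [y 0]" "x = (shift ^^ l) (subst_seq ?s y)"
    "K L = l" "Y L 0 = y 0" by blast
  then have "x \<in> tower n (y 0) l" by (auto simp: tower_iff)
  then have "y 0 = a \<and> l = k" using tower_unique[OF assms(1)] assms y level_letter by blast
  then have "X' L \<in> tower n a k" using YK y by (auto simp: tower_iff)
  then show False using X'(3) by blast
qed

end

section \<open>Letter-coboundaries as differences of potentials\<close>

locale primitive_directive = recognizable_directive +
  assumes occur: "letters_occur A \<tau>"
    and pairs: "\<And>n a u. a \<in> A (Suc n) \<Longrightarrow> u \<in> language (level_shift A \<tau> n) \<Longrightarrow> length u = 2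
           \<Longrightarrow> sublist u (\<tau> n [a])"
begin

lemma letter_occurs: "a \<in> A n \<Longrightarrow> \<exists>y\<in>level n. y 0 = a"
  using occur language_letter_iff unfolding letters_occur_def by blast

lemma letter_follows:
  assumes "a \<in> A n"
  shows "\<exists>b\<in>A n. [a, b] \<in> language (level n)"
proof -
  obtain y where y: "y \<in> level n" "y 0 = a" using letter_occurs[OF assms] by blast
  then have "[a, y 1] \<in> language (level n)" using language_pair_iff by blast
  then show ?thesis using level_letter[OF y(1), of 1] by blast
qed

lemma letter_in_image:
  assumes "a \<in> A (Suc n)" "b \<in> A n"
  shows "b \<in> set (\<tau> n [a])"
proof -
  obtain d where "[b, d] \<in> language (level n)" using letter_follows[OF assms(2)] by blast
  then have "sublist [b, d] (\<tau> n [a])" using pairs[OF assms(1)] by simp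
  then show ?thesis using set_mono_sublist by fastforce
qed

lemma image_in_language: "n \<le> m \<Longrightarrow> a \<in> A m \<Longrightarrow> comp_subst \<tau> n m [a] \<in> language (level n)"
  using language_image occur unfolding letters_occur_def by blast

lemma step_image_in_language: "a \<in> A (Suc n) \<Longrightarrow> \<tau> n [a] \<in> language (level n)"
  using image_in_language[of n "Suc n" a] by (simp add: comp_subst_refl)

text \<open>
  Potentials live on letters: \<open>\<rho> a\<close> stands for the value at the left end of an occurrence of \<open>a\<close>.
\<close>

definition potential :: "nat \<Rightarrow> ('a list \<Rightarrow> real) \<Rightarrow> ('a \<Rightarrow> real) \<Rightarrow> bool" where
  "potential n c \<rho> \<longleftrightarrow> (\<forall>a b. [a, b] \<in> language (level n) \<longrightarrow> c [a] = \<rho> b - \<rho> a)"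

text \<open>
  A word that leads from a letter back to the same letter is a concatenation of return words to that letter.
\<close>

lemma coboundary_loop:
  assumes c: "letter_coboundary (A n) (level n) c"
  shows "w \<noteq> [] \<Longrightarrow> w @ [hd w] \<in> language (level n) \<Longrightarrow> c w = 0"
proof (induction w rule: length_induct)
  case (1 w)
  then obtain a v where w: "w = a # v" by (cases w) auto
  have L: "a # v @ [a] \<in> language (level n)" using 1(3) w by simp
  then have A: "a \<in> A n" "v \<in> lists (A n)" using language_lists by fastforce+
  show ?case
  proof (cases "a \<in> set v")
    case False
    then have "count_list v a = 0" by (simp add: count_list_0_iff)
    then have "return_word (level n) a w" using L by (simp add: return_word_def w suffix_def)
    then show ?thesis using c A(1) unfolding letter_coboundary_def by blast
  next
    case True
    obtain p s where v: "v = p @ a # s" using split_list[OF True] by blast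
    have "sublist (a # p @ [a]) (a # v @ [a])" "sublist (a # s @ [a]) (a # v @ [a])"
      using sublist_appendI[of "a # p @ [a]" "[]" "s @ [a]"] sublist_appendI[of "a # s @ [a]" "a # p" "[]"]
      by (simp_all add: v)
    then have "a # p @ [a] \<in> language (level n)" "a # s @ [a] \<in> language (level n)"
      using language_sublist[OF L] by blast+
    then have "c (a # p) = 0" "c (a # s) = 0" using 1(1) by (auto simp: w v)
    moreover have "c w = c (a # p) + c (a # s)"
    proof -
      have "c ((a # p) @ (a # s)) = c (a # p) + c (a # s)"
        using c A v unfolding letter_coboundary_def by (metis Cons_in_lists_iff append_in_lists_conv)
      then show ?thesis by (simp add: w v)
    qed
    ultimately show ?thesis by simp
  qed
qed

text \<open>
  A single word \<open>w = \<tau>\<^sub>n(d)\<close> of the language contains all words of length two. Sum \<open>c\<close> along \<open>w\<close>: by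
  \<open>coboundary_loop\<close> the partial sum before an occurrence of \<open>b\<close> is the same for all occurrences, and this is \<open>\<rho> b\<close>.
\<close>

lemma coboundary_potential:
  assumes c: "letter_coboundary (A n) (level n) c"
  shows "\<exists>\<rho>. potential n c \<rho>"
proof -
  obtain d where d: "d \<in> A (Suc n)" using A_nonempty by blast
  define w where "w = \<tau> n [d]"
  have wL: "w \<in> language (level n)" unfolding w_def by (rule step_image_in_language[OF d])
  then have wA: "w \<in> lists (A n)" by (rule language_lists)
  have add: "c (u @ v) = c u + c v" if "u \<in> lists (A n)" "v \<in> lists (A n)" for u v
    using c that by (simp add: letter_coboundary_def)
  have same: "c (take i w) = c (take j w)" if ij: "i < j" "j < length w" "w ! i = w ! j" for i j
  proof -
    define v where "v = take (j - i) (drop i w)"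
    have tj: "take j w = take i w @ v" unfolding v_def using ij(1) by (metis add_diff_inverse_nat less_imp_not_less take_add)
    have vne: "v \<noteq> []" using ij by (simp add: v_def)
    have "hd v = w ! i" using ij by (simp add: v_def hd_drop_conv_nth)
    then have "take (Suc j) w = take i w @ (v @ [hd v])"
      using ij tj by (simp add: take_Suc_conv_app_nth)
    then have "w = take i w @ (v @ [hd v]) @ drop (Suc j) w" by (metis append.assoc append_take_drop_id)
    then have "sublist (v @ [hd v]) w" unfolding sublist_def by blast
    then have "c v = 0" using coboundary_loop[OF c vne] language_sublist[OF wL] by blast
    moreover have "c (take j w) = c (take i w) + c v" unfolding tj
      using wA tj by (intro add) (metis append_in_lists_conv append_take_drop_id)+
    ultimately show ?thesis by simp
  qed
  define \<rho> where "\<rho> b = c (take (SOME i. i < length w \<and> w ! i = b) w)" for b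
  have \<rho>: "\<rho> (w ! i) = c (take i w)" if i: "i < length w" for i
  proof -
    define j where "j = (SOME j. j < length w \<and> w ! j = w ! i)"
    have "j < length w \<and> w ! j = w ! i" unfolding j_def by (rule someI[of _ i]) (simp add: i)
    then have "c (take j w) = c (take i w)" using same[of i j] same[of j i] i by (metis linorder_neqE_nat)
    then show ?thesis by (simp add: \<rho>_def j_def)
  qed
  have "c [a] = \<rho> b - \<rho> a" if ab: "[a, b] \<in> language (level n)" for a b
  proof -
    have "sublist [a, b] w" unfolding w_def using pairs[OF d ab] by simp
    then obtain p s where w: "w = p @ [a, b] @ s" by (auto simp: sublist_def)
    have "\<rho> a = c p" using \<rho>[of "length p"] by (simp add: w)
    moreover have "\<rho> b = c (p @ [a])" using \<rho>[of "Suc (length p)"] by (simp add: w nth_append)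
    moreover have "c (p @ [a]) = c p + c [a]" using wA by (intro add) (auto simp: w)
    ultimately show ?thesis by simp
  qed
  then show ?thesis unfolding potential_def by blast
qed

lemma potential_telescope:
  assumes Nil: "c [] = 0"
    and add: "\<And>u v. u \<in> lists (A n) \<Longrightarrow> v \<in> lists (A n) \<Longrightarrow> c (u @ v) = c u + c v"
    and \<rho>: "potential n c \<rho>"
  shows "u @ [b] \<in> language (level n) \<Longrightarrow> c u = \<rho> b - \<rho> (hd (u @ [b]))"
proof (induction u)
  case Nil
  then show ?case using assms(1) by simp
next
  case (Cons a u)
  define e where "e = hd (u @ [b])"
  obtain v where v: "u @ [b] = e # v" unfolding e_def by (cases "u @ [b]") auto
  have L: "(a # u) @ [b] \<in> language (level n)" by fact
  have "sublist (u @ [b]) ((a # u) @ [b])" using sublist_appendI[of "u @ [b]" "[a]" "[]"] by simp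
  then have IH: "c u = \<rho> b - \<rho> e" using Cons.IH language_sublist[OF L] e_def by blast
  have "sublist [a, e] ((a # u) @ [b])" using sublist_appendI[of "[a, e]" "[]" v] by (simp add: v)
  then have "c [a] = \<rho> e - \<rho> a" using \<rho> language_sublist[OF L] unfolding potential_def by blast
  moreover have "[a] \<in> lists (A n)" "u \<in> lists (A n)" using language_lists[OF L] by auto
  then have "c ([a] @ u) = c [a] + c u" by (rule add)
  ultimately show ?case using IH by simp
qed

lemma potential_coboundary:
  assumes Nil: "c [] = 0"
    and add: "\<And>u v. u \<in> lists (A n) \<Longrightarrow> v \<in> lists (A n) \<Longrightarrow> c (u @ v) = c u + c v"
    and \<rho>: "potential n c \<rho>"
  shows "letter_coboundary (A n) (level n) c"
  unfolding letter_coboundary_def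
proof (intro conjI ballI allI impI)
  fix a w assume "return_word (level n) a w"
  then have L: "w @ [a] \<in> language (level n)" and "hd (w @ [a]) = a"
    unfolding return_word_def by (auto simp: prefix_def)
  then show "c w = 0" using potential_telescope[OF assms L] by simp
qed (use Nil add in auto)

abbreviation first where "first n b \<equiv> hd (\<tau> n [b])"

lemma hd_image:
  assumes "v \<noteq> []" "v \<in> lists (A (Suc n))"
  shows "\<tau> n v \<noteq> [] \<and> hd (\<tau> n v) = first n (hd v)"
proof -
  obtain a w where v: "v = a # w" using assms(1) by (cases v) auto
  then have "\<tau> n v = \<tau> n [a] @ \<tau> n w" using substitution_append[OF subst_step, of "[a]" n w] assms by simp
  moreover have "\<tau> n [a] \<noteq> []" using substitution_nonempty[OF subst_step, of a n] assms v by simp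
  ultimately show ?thesis using v by simp
qed

lemma comp_subst_two: "comp_subst \<tau> n (n + 2) u = \<tau> n (\<tau> (Suc n) u)"
  by (simp add: comp_subst_refl)

definition error where
  "error c \<alpha> n = Max {int_dist (c n u - \<alpha> * real (height \<tau> n u)) | a u.
        a \<in> A (n + 2) \<and> prefix u (comp_subst \<tau> n (n + 2) [a])}"

lemma finite_error_set:
  "finite {int_dist (c n u - \<alpha> * real (height \<tau> n u)) | a u.
        a \<in> A (n + 2) \<and> prefix u (comp_subst \<tau> n (n + 2) [a])}" (is "finite ?S")
proof -
  have "?S \<subseteq> (\<lambda>u. int_dist (c n u - \<alpha> * real (height \<tau> n u))) `
      (\<Union>a\<in>A (n + 2). set (prefixes (comp_subst \<tau> n (n + 2) [a])))"
    by (intro subsetI) (auto simp del: comp_subst.simps add_2_eq_Suc' intro!: imageI)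
  then show ?thesis by (rule finite_subset) (intro finite_imageI finite_UN_I finite_A finite_set)
qed

lemma error_bound:
  assumes "a \<in> A (n + 2)" "prefix u (\<tau> n (\<tau> (Suc n) [a]))"
  shows "int_dist (c n u - \<alpha> * real (height \<tau> n u)) \<le> error c \<alpha> n"
  unfolding error_def
proof (rule Max_ge[OF finite_error_set], intro CollectI exI conjI)
  show "prefix u (comp_subst \<tau> n (n + 2) [a])" using assms(2) by (simp only: comp_subst_two)
qed (use assms(1) in simp_all)

lemma error_leI:
  assumes "\<And>a u. a \<in> A (n + 2) \<Longrightarrow> prefix u (\<tau> n (\<tau> (Suc n) [a])) \<Longrightarrow>
    int_dist (c n u - \<alpha> * real (height \<tau> n u)) \<le> B"
  shows "error c \<alpha> n \<le> B"
  unfolding error_def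
proof (subst Max_le_iff[OF finite_error_set])
  show "{int_dist (c n u - \<alpha> * real (height \<tau> n u)) | a u.
        a \<in> A (n + 2) \<and> prefix u (comp_subst \<tau> n (n + 2) [a])} \<noteq> {}"
  proof -
    obtain a where "a \<in> A (n + 2)" using A_nonempty by blast
    then have "int_dist (c n [] - \<alpha> * real (height \<tau> n [])) \<in> {int_dist (c n u - \<alpha> * real (height \<tau> n u)) | a u.
        a \<in> A (n + 2) \<and> prefix u (comp_subst \<tau> n (n + 2) [a])}"
      by (intro CollectI exI[of _ a] exI[of _ "[]"] conjI refl Nil_prefix)
    then show ?thesis by blast
  qed
  show "\<forall>e\<in>{int_dist (c n u - \<alpha> * real (height \<tau> n u)) | a u.
        a \<in> A (n + 2) \<and> prefix u (comp_subst \<tau> n (n + 2) [a])}. e \<le> B"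
    using assms unfolding comp_subst_two by blast
qed

lemma error_nonneg: "0 \<le> error c \<alpha> n"
proof -
  obtain a where "a \<in> A (n + 2)" using A_nonempty by blast
  from order_trans[OF int_dist_nonneg error_bound[OF this Nil_prefix]] show ?thesis .
qed

end

section \<open>From coboundaries to an eigenfunction\<close>

context primitive_directive
begin

context
  fixes c :: "nat \<Rightarrow> 'a list \<Rightarrow> real" and \<alpha> :: real
  assumes cob: "\<And>n. letter_coboundary (A n) (level n) (c n)"
begin

abbreviation "err n \<equiv> error c \<alpha> n"

lemma c_Nil: "c n [] = 0"
  using cob[of n] unfolding letter_coboundary_def by blast

lemma c_append: "u \<in> lists (A n) \<Longrightarrow> v \<in> lists (A n) \<Longrightarrow> c n (u @ v) = c n u + c n v"
  using cob[of n] unfolding letter_coboundary_def by blast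

abbreviation "dev n u \<equiv> c n u - \<alpha> * real (height \<tau> n u)"

lemma dev_append: "u \<in> lists (A n) \<Longrightarrow> v \<in> lists (A n) \<Longrightarrow> dev n (u @ v) = dev n u + dev n v"
  by (simp add: c_append height_append algebra_simps)

text \<open>
  The error term of level \<open>n\<close> controls prefixes of \<open>\<tau>\<^sub>n(\<tau>\<^sub>n\<^sub>+\<^sub>1(d))\<close> only. The word \<open>u\<close> sits inside such a word, since \<open>a\<close> occurs in \<open>\<tau>\<^sub>n\<^sub>+\<^sub>1(d)\<close>,
  and is the difference of two of its prefixes; this costs a factor of two.
\<close>

lemma dev_prefix_bound:
  assumes "a \<in> A (Suc n)" "prefix u (\<tau> n [a])"
  shows "int_dist (dev n u) \<le> 2 * err n"
proof -
  obtain d where d: "d \<in> A (n + 2)" using A_nonempty by blast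
  then have "a \<in> set (\<tau> (Suc n) [d])" using letter_in_image[of d "Suc n" a] assms(1) by simp
  then obtain p s where ps: "\<tau> (Suc n) [d] = p @ [a] @ s" using split_list[of a] by fastforce
  have L: "\<tau> (Suc n) [d] \<in> lists (A (Suc n))"
    using substitution_lists[OF subst_step, of "[d]" "Suc n"] d by simp
  have A: "p \<in> lists (A (Suc n))" "[a] \<in> lists (A (Suc n))" "s \<in> lists (A (Suc n))" using L ps by auto
  obtain t where t: "\<tau> n [a] = u @ t" using assms(2) by (auto simp: prefix_def)
  have w: "\<tau> n (\<tau> (Suc n) [d]) = \<tau> n p @ u @ t @ \<tau> n s"
    unfolding ps using substitution_append[OF subst_step, of p n "[a] @ s"]
      substitution_append[OF subst_step, of "[a]" n s] A t by simp
  have B: "\<tau> n p \<in> lists (A n)" "u \<in> lists (A n)"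
    using substitution_lists[OF subst_step A(1)] substitution_lists[OF subst_step A(2)] t by auto
  have 1: "int_dist (dev n (\<tau> n p)) \<le> err n"
    by (rule error_bound[OF d]) (simp add: w)
  have 2: "int_dist (dev n (\<tau> n p @ u)) \<le> err n"
    by (rule error_bound[OF d]) (simp add: w)
  have "dev n u = dev n (\<tau> n p @ u) + - dev n (\<tau> n p)" using dev_append[OF B] by simp
  then show ?thesis using 1 2 int_dist_triangle[of "dev n (\<tau> n p @ u)" "- dev n (\<tau> n p)"]
    int_dist_minus[of "dev n (\<tau> n p)"] by simp
qed

lemma dev_letter_bound:
  assumes "a \<in> A n"
  shows "int_dist (dev n [a]) \<le> 4 * err n"
proof -
  obtain d where d: "d \<in> A (Suc n)" using A_nonempty by blast
  then have "a \<in> set (\<tau> n [d])" using letter_in_image assms by blast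
  then obtain p s where ps: "\<tau> n [d] = p @ [a] @ s" using split_list[of a] by fastforce
  have "\<tau> n [d] \<in> lists (A n)" using substitution_lists[OF subst_step, of "[d]" n] d by simp
  then have A: "p \<in> lists (A n)" "[a] \<in> lists (A n)" using ps by auto
  have "int_dist (dev n p) \<le> 2 * err n" "int_dist (dev n (p @ [a])) \<le> 2 * err n"
    by (rule dev_prefix_bound[OF d]; simp add: ps)+
  moreover have "dev n [a] = dev n (p @ [a]) + - dev n p" using dev_append[OF A] by simp
  ultimately show ?thesis using int_dist_triangle[of "dev n (p @ [a])" "- dev n p"]
    int_dist_minus[of "dev n p"] by simp
qed

text \<open>
  Join two letters \<open>f\<close> and \<open>w\<close> of level \<open>n + 1\<close> by a word \<open>z\<close> that starts with \<open>f\<close> and is followed by \<open>w\<close>. Both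
  \<open>\<rho>'(w) - \<rho>'(f) = c\<^sub>n\<^sub>+\<^sub>1(z)\<close> and \<open>\<rho>(\<pi>\<^sub>n(w)) - \<rho>(\<pi>\<^sub>n(f)) = c\<^sub>n(\<tau>\<^sub>n(z))\<close> are close to \<open>\<alpha> h\<^sub>n\<^sub>+\<^sub>1(z)\<close> modulo \<open>1\<close>. Taking \<open>f\<close> at the beginning of
  a twofold image makes \<open>z\<close> a prefix that the error terms control.
\<close>

lemma potential_descend:
  assumes \<rho>: "potential n (c n) \<rho>" and \<rho>': "potential (Suc n) (c (Suc n)) \<rho>'"
  shows "\<exists>K. \<forall>w\<in>A (Suc n). int_dist (\<rho>' w - \<rho> (first n w) - K) \<le> err n + err (Suc n)"
proof -
  obtain d where d: "d \<in> A (Suc n + 2)" using A_nonempty by blast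
  then have d': "d \<in> A (Suc (n + 2))" by simp
  \<comment> \<open>Prefixes of \<open>\<tau>\<^sub>n\<^sub>+\<^sub>1(a)\<close> are then prefixes of \<open>\<tau>\<^sub>n\<^sub>+\<^sub>1(\<tau>\<^sub>n\<^sub>+\<^sub>2(d))\<close>, and their images are prefixes of \<open>\<tau>\<^sub>n(\<tau>\<^sub>n\<^sub>+\<^sub>1(a))\<close>.\<close>
  define a where "a = first (n + 2) d"
  have t2: "\<tau> (n + 2) [d] \<in> lists (A (n + 2))" "\<tau> (n + 2) [d] \<noteq> []"
    using substitution_lists[OF subst_step, of "[d]" "n + 2"]
      substitution_nonempty[OF subst_step, of d "n + 2"] d' by auto
  then have a: "a \<in> A (n + 2)" unfolding a_def by (metis in_lists_conv_set list.set_sel(1))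
  then have a': "a \<in> A (Suc (Suc n))" by simp
  have pre: "prefix (\<tau> (Suc n) [a]) (\<tau> (Suc n) (\<tau> (Suc (Suc n)) [d]))"
  proof -
    have "prefix [a] (\<tau> (n + 2) [d])" unfolding a_def using t2(2) by (cases "\<tau> (n + 2) [d]") auto
    then show ?thesis using substitution_prefix[OF subst_step, of "\<tau> (n + 2) [d]" "Suc n" "[a]"] t2 by simp
  qed
  define f where "f = first (Suc n) a"
  have wL: "\<tau> (Suc n) [a] \<in> language (level (Suc n))" by (rule step_image_in_language[OF a'])
  have "int_dist (\<rho>' w - \<rho> (first n w) - (\<rho>' f - \<rho> (first n f))) \<le> err n + err (Suc n)" if w: "w \<in> A (Suc n)" for w
  proof -
    have "w \<in> set (\<tau> (Suc n) [a])" using letter_in_image[OF a' w] .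
    then obtain z s where zs: "\<tau> (Suc n) [a] = z @ [w] @ s" using split_list[of w] by fastforce
    have zA: "z \<in> lists (A (Suc n))" "[w] \<in> lists (A (Suc n))" "s \<in> lists (A (Suc n))"
      using language_lists[OF wL] zs by auto
    have zwL: "z @ [w] \<in> language (level (Suc n))"
      by (rule language_sublist[OF wL]) (use sublist_appendI[of "z @ [w]" "[]" s] zs in simp)
    have f: "hd (z @ [w]) = f" unfolding f_def zs by (cases z) auto
    have 1: "c (Suc n) z = \<rho>' w - \<rho>' f" using potential_telescope[OF c_Nil c_append \<rho>' zwL] f by simp
    obtain q where q: "\<tau> n [w] = first n w # q"
      using substitution_nonempty[OF subst_step, of w n] w by (cases "\<tau> n [w]") auto
    have tzw: "\<tau> n (z @ [w]) = (\<tau> n z @ [first n w]) @ q"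
      using substitution_append[OF subst_step zA(1,2)] q by simp
    have "\<tau> n (z @ [w]) \<in> language (level n)"
      using language_image[of n "Suc n" "z @ [w]"] zwL by (simp add: comp_subst_refl)
    then have zfL: "\<tau> n z @ [first n w] \<in> language (level n)"
      by (rule language_sublist) (use sublist_appendI[of "\<tau> n z @ [first n w]" "[]" q] tzw in simp)
    have "hd (\<tau> n z @ [first n w]) = hd (\<tau> n (z @ [w]))" unfolding tzw by (cases "\<tau> n z") auto
    also have "\<dots> = first n f" using hd_image[of "z @ [w]" n] zA f by simp
    finally have 2: "c n (\<tau> n z) = \<rho> (first n w) - \<rho> (first n f)"
      using potential_telescope[OF c_Nil c_append \<rho> zfL] by simp
    have pz: "prefix z (\<tau> (Suc n) [a])" by (simp add: zs)
    have e1: "int_dist (dev (Suc n) z) \<le> err (Suc n)"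
      by (rule error_bound[OF d]) (use prefix_order.order_trans[OF pz pre] in simp)
    have e2: "int_dist (dev n (\<tau> n z)) \<le> err n"
      by (rule error_bound[OF a]) (use substitution_prefix[OF subst_step _ pz] language_lists[OF wL] in simp)
    have h: "height \<tau> n (\<tau> n z) = height \<tau> (Suc n) z" by (simp add: height_def)
    have "\<rho>' w - \<rho> (first n w) - (\<rho>' f - \<rho> (first n f)) = dev (Suc n) z + - dev n (\<tau> n z)"
      using 1 2 h by simp
    then show ?thesis using e1 e2 int_dist_triangle[of "dev (Suc n) z" "- dev n (\<tau> n z)"]
      int_dist_minus[of "dev n (\<tau> n z)"] by simp
  qed
  then show ?thesis by blast
qed

lemma coherent_potentials:
  "\<exists>\<rho>. (\<forall>n. potential n (c n) (\<rho> n)) \<and>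
    (\<forall>n. \<forall>w\<in>A (Suc n). int_dist (\<rho> (Suc n) w - \<rho> n (first n w)) \<le> err n + err (Suc n))"
proof -
  obtain \<sigma> where \<sigma>: "\<And>n. potential n (c n) (\<sigma> n)"
    using coboundary_potential[OF cob] by metis
  obtain K where K: "\<And>n w. w \<in> A (Suc n) \<Longrightarrow> int_dist (\<sigma> (Suc n) w - \<sigma> n (first n w) - K n) \<le> err n + err (Suc n)"
    using potential_descend[OF \<sigma> \<sigma>] by metis
  \<comment> \<open>The accumulated constants are subtracted; this does not change the differences of a potential.\<close>
  define \<rho> where "\<rho> n w = \<sigma> n w - (\<Sum>i<n. K i)" for n w
  have "potential n (c n) (\<rho> n)" for n using \<sigma>[of n] by (simp add: potential_def \<rho>_def)
  moreover have "int_dist (\<rho> (Suc n) w - \<rho> n (first n w)) \<le> err n + err (Suc n)" if "w \<in> A (Suc n)" for n w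
    using K[OF that] by (simp add: \<rho>_def algebra_simps)
  ultimately show ?thesis by blast
qed

lemma eigenvalue_of_coboundaries:
  assumes S: "summable err"
  shows "eigenvalue (A 0) (level 0) \<alpha>"
proof -
  obtain \<rho> where \<rho>: "\<And>n. potential n (c n) (\<rho> n)"
    and coh: "\<And>n w. w \<in> A (Suc n) \<Longrightarrow> int_dist (\<rho> (Suc n) w - \<rho> n (first n w)) \<le> err n + err (Suc n)"
    using coherent_potentials by metis
  define valid where "valid n x p \<longleftrightarrow> fst p \<in> A n \<and> snd p < height \<tau> n [fst p] \<and> x \<in> tower n (fst p) (snd p)" for n x p
  \<comment> \<open>The index is shifted by one because the partition into floors is available from level \<open>1\<close> on.\<close>
  define F where "F n x = (let p = SOME p. valid (Suc n) x p in \<alpha> * real (snd p) + \<rho> (Suc n) (fst p))" for n x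
  have F: "F n x = \<alpha> * real k + \<rho> (Suc n) a"
    if "a \<in> A (Suc n)" "k < height \<tau> (Suc n) [a]" "x \<in> tower (Suc n) a k" for n x a k
  proof -
    have "valid (Suc n) x (a, k)" using that by (simp add: valid_def)
    then have "valid (Suc n) x (SOME p. valid (Suc n) x p)" by (rule someI)
    then have "fst (SOME p. valid (Suc n) x p) = a \<and> snd (SOME p. valid (Suc n) x p) = k"
      unfolding valid_def using that by (intro tower_unique[of "Suc n" x]) auto
    then show ?thesis by (simp add: F_def Let_def)
  qed
  define E where "E n = 3 * err (Suc n) + err (Suc (Suc n))" for n
  have step: "int_dist (F (Suc n) x - F n x) \<le> E n" if x: "x \<in> level 0" for n x
  proof -
    obtain a k where a: "a \<in> A (Suc (Suc n))" "k < height \<tau> (Suc (Suc n)) [a]" "x \<in> tower (Suc (Suc n)) a k"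
      using tower_cover[OF x, of "Suc (Suc n)"] by blast
    obtain u b v where u: "\<tau> (Suc n) [a] = u @ [b] @ v" "b \<in> A (Suc n)" "height \<tau> (Suc n) u \<le> k"
      "k - height \<tau> (Suc n) u < height \<tau> (Suc n) [b]" "x \<in> tower (Suc n) b (k - height \<tau> (Suc n) u)"
      using tower_descend[OF a(3,1,2)] by blast
    have "u @ [b] \<in> language (level (Suc n))"
      by (rule language_sublist[OF step_image_in_language[OF a(1)]])
        (use sublist_appendI[of "u @ [b]" "[]" v] u(1) in simp)
    moreover have "hd (u @ [b]) = first (Suc n) a" unfolding u(1) by (cases u) auto
    ultimately have cu: "c (Suc n) u = \<rho> (Suc n) b - \<rho> (Suc n) (first (Suc n) a)"
      using potential_telescope[OF c_Nil c_append \<rho>] by metis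
    have "F (Suc n) x - F n x = (\<rho> (Suc (Suc n)) a - \<rho> (Suc n) (first (Suc n) a)) + - dev (Suc n) u"
      using F[OF a] F[OF u(2,4,5)] cu u(3) by (simp add: of_nat_diff algebra_simps)
    moreover have "int_dist (dev (Suc n) u) \<le> 2 * err (Suc n)"
      by (rule dev_prefix_bound[OF a(1)]) (simp add: u(1))
    ultimately show ?thesis
      using coh[OF a(1)] int_dist_triangle[of "\<rho> (Suc (Suc n)) a - \<rho> (Suc n) (first (Suc n) a)" "- dev (Suc n) u"]
        int_dist_minus[of "dev (Suc n) u"] by (simp add: E_def)
  qed
  have sE: "summable E" unfolding E_def
    using S by (intro summable_add summable_mult) (auto simp: summable_iff_shift[of err 1, simplified] summable_iff_shift[of err 2, simplified])
  obtain G where G: "\<And>n x. x \<in> level 0 \<Longrightarrow> int_dist (G x - F n x) \<le> (\<Sum>i. E (i + n))"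
    using uniform_limit_mod_1[where F = F and X = "level 0", OF sE step] by blast
  have tail: "(\<lambda>n. \<Sum>i. E (i + n)) \<longlonglongrightarrow> 0" by (rule tail_sum_tendsto_0[OF sE])
  have "continuous_map (subtopology (full_shift (A 0)) (level 0)) euclidean (\<lambda>x. to_circle (G x))"
  proof (rule continuous_circleI[OF level_range])
    fix x and e :: real assume x: "x \<in> level 0" and e: "0 < e"
    have "eventually (\<lambda>n. (\<Sum>i. E (i + n)) < e / 2) sequentially"
      by (rule order_tendstoD(2)[OF tail]) (use e in linarith)
    then have "\<exists>N. \<forall>n\<ge>N. (\<Sum>i. E (i + n)) < e / 2" unfolding eventually_sequentially .
    then obtain n where n: "(\<Sum>i. E (i + n)) < e / 2" by blast
    obtain a k where a: "a \<in> A (Suc n)" "k < height \<tau> (Suc n) [a]" "x \<in> tower (Suc n) a k"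
      using tower_cover[OF x, of "Suc n"] by blast
    obtain L :: nat where L: "\<forall>x'\<in>level 0. (\<forall>i\<in>{- int L..int L}. x' i = x i) \<longrightarrow> x' \<in> tower (Suc n) a k"
      using tower_open[OF _ a(3,1,2)] by auto
    have "int_dist (G x' - G x) < e" if x': "x' \<in> level 0" "\<forall>i\<in>{- int L..int L}. x' i = x i" for x'
    proof -
      have "x' \<in> tower (Suc n) a k" using L x' by blast
      then have "F n x' = F n x" using F[OF a] F[OF a(1,2)] by metis
      then have "int_dist (G x' - G x) \<le> int_dist (G x' - F n x') + int_dist (G x - F n x)"
        using int_dist_triangle_diff[of "G x'" "G x" "F n x"] int_dist_minus_commute[of "G x" "F n x"] by simp
      then show ?thesis using G[OF x, of n] G[OF x'(1), of n] n by linarith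
    qed
    then show "\<exists>L::nat. \<forall>x'\<in>level 0. (\<forall>i\<in>{- int L..int L}. x' i = x i) \<longrightarrow> int_dist (G x' - G x) < e" by blast
  qed
  moreover have "to_circle (G (shift x)) = to_circle (G x) + to_circle \<alpha>" if x: "x \<in> level 0" for x
  proof -
    have sx: "shift x \<in> level 0" by (rule level_shift_closed[OF x])
    have bound: "int_dist (G (shift x) - (G x + \<alpha>)) \<le> 2 * (\<Sum>i. E (i + n)) + 4 * err (Suc n)" for n
    proof -
      obtain a k where a: "a \<in> A (Suc n)" "k < height \<tau> (Suc n) [a]" "x \<in> tower (Suc n) a k"
        using tower_cover[OF x, of "Suc n"] by blast
      have "int_dist (F n (shift x) - (F n x + \<alpha>)) \<le> 4 * err (Suc n)"
        using tower_shift[OF a(3,2)]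
      proof (elim disjE conjE bexE)
        assume "Suc k < height \<tau> (Suc n) [a]" "shift x \<in> tower (Suc n) a (Suc k)"
        then have "F n (shift x) = F n x + \<alpha>" using F[OF a(1)] F[OF a] by (simp add: algebra_simps)
        then show ?thesis using error_nonneg[of c \<alpha> "Suc n"] int_dist_le_abs[of 0] by simp
      next
        fix b assume b: "Suc k = height \<tau> (Suc n) [a]" "b \<in> A (Suc n)" "[a, b] \<in> language (level (Suc n))"
          "shift x \<in> tower (Suc n) b 0"
        have "c (Suc n) [a] = \<rho> (Suc n) b - \<rho> (Suc n) a" using \<rho> b(3) unfolding potential_def by blast
        moreover have "F n (shift x) = \<rho> (Suc n) b" using F[OF b(2) height_pos[OF b(2)] b(4)] by simp
        moreover have "real (height \<tau> (Suc n) [a]) = real k + 1" using b(1) by (metis of_nat_Suc add.commute)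
        ultimately have "F n (shift x) - (F n x + \<alpha>) = dev (Suc n) [a]"
          using F[OF a] by (simp add: algebra_simps)
        then show ?thesis using dev_letter_bound[OF a(1)] by simp
      qed
      moreover have "int_dist (F n x + \<alpha> - (G x + \<alpha>)) = int_dist (G x - F n x)"
        using int_dist_minus_commute[of "G x" "F n x"] by simp
      ultimately show ?thesis
        using G[OF x, of n] G[OF sx, of n] int_dist_triangle_diff[of "G (shift x)" "G x + \<alpha>" "F n (shift x)"]
          int_dist_triangle_diff[of "F n (shift x)" "G x + \<alpha>" "F n x + \<alpha>"] by linarith
    qed
    have "(\<lambda>n. err (Suc n)) \<longlonglongrightarrow> 0" using LIMSEQ_Suc[OF summable_LIMSEQ_zero[OF S]] .
    then have "(\<lambda>n. 2 * (\<Sum>i. E (i + n)) + 4 * err (Suc n)) \<longlonglongrightarrow> 2 * 0 + 4 * 0"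
      by (intro tendsto_intros tail)
    then have "int_dist (G (shift x) - (G x + \<alpha>)) \<le> 2 * 0 + 4 * 0"
      by (rule LIMSEQ_le_const) (use bound in blast)
    then have "G (shift x) - (G x + \<alpha>) \<in> \<int>" using int_dist_nonneg int_dist_eq_0 by (metis add.right_neutral mult_zero_right order_antisym)
    then show ?thesis using to_circle_eq_iff to_circle_add by metis
  qed
  ultimately show ?thesis unfolding eigenvalue_def by blast
qed

end

end

section \<open>Shortest arcs\<close>

text \<open>
  The arc \<open>[M - w, M]\<close> modulo \<open>1\<close> contains \<open>E\<close>, and \<open>E\<close> comes arbitrarily close to both ends. The bound \<open>1/4\<close> on the
  length is what makes differences of points of \<open>E\<close> unambiguous as real numbers.
\<close>

definition shortest_arc :: "real set \<Rightarrow> real \<Rightarrow> real \<Rightarrow> bool" where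
  "shortest_arc E M w \<longleftrightarrow> w \<le> 1/4 \<and> (\<forall>t\<in>E. \<exists>k::int. M - w \<le> t + k \<and> t + k \<le> M) \<and>
    (\<forall>e>0. \<exists>t\<in>E. \<exists>k::int. M - e \<le> t + k \<and> t + k \<le> M) \<and>
    (\<forall>e>0. \<exists>t\<in>E. \<exists>k::int. M - w \<le> t + k \<and> t + k \<le> M - w + e)"

lemma shortest_arc_exists:
  assumes "E \<noteq> {}" "\<And>s t. s \<in> E \<Longrightarrow> t \<in> E \<Longrightarrow> int_dist (s - t) < 1/8"
  shows "\<exists>M w. shortest_arc E M w"
proof -
  obtain t0 where t0: "t0 \<in> E" using assms(1) by blast
  define S where "S = {t + of_int k | t k. t \<in> E \<and> \<bar>t + of_int k - t0\<bar> \<le> 1/8}"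
  have inS: "\<exists>k::int. t + k \<in> S" if t: "t \<in> E" for t
  proof -
    obtain k :: int where "int_dist (t - t0) = \<bar>t - t0 - k\<bar>" using int_dist_attained by blast
    moreover have "t + of_int (- k) - t0 = t - t0 - of_int k" by simp
    ultimately have "\<bar>t + of_int (- k) - t0\<bar> \<le> 1/8" using assms(2)[OF t t0] by linarith
    then have "t + of_int (- k) \<in> S" using t unfolding S_def by (intro CollectI exI[of _ t] exI[of _ "- k"]) simp
    then show ?thesis by (rule exI[of _ "- k"])
  qed
  have ne: "S \<noteq> {}" using inS[OF t0] by (metis empty_iff)
  have b: "t0 - 1/8 \<le> s" "s \<le> t0 + 1/8" if "s \<in> S" for s
  proof -
    have "\<bar>s - t0\<bar> \<le> 1/8" using that unfolding S_def by blast
    then show "t0 - 1/8 \<le> s" "s \<le> t0 + 1/8" by linarith+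
  qed
  have bd: "bdd_above S" "bdd_below S" using bdd_aboveI[OF b(2)] bdd_belowI[OF b(1)] by simp_all
  have up: "Sup S \<le> t0 + 1/8" and lo: "t0 - 1/8 \<le> Inf S"
    by (rule cSup_least[OF ne b(2)], assumption) (rule cInf_greatest[OF ne b(1)])
  have lift: "\<exists>t\<in>E. \<exists>k::int. s = t + k" if "s \<in> S" for s using that unfolding S_def by blast
  have "Sup S - Inf S \<le> 1/4" using up lo by linarith
  moreover have "\<exists>k::int. Inf S \<le> t + k \<and> t + k \<le> Sup S" if "t \<in> E" for t
  proof -
    obtain k :: int where k: "t + k \<in> S" using inS \<open>t \<in> E\<close> by blast
    show ?thesis using cSup_upper[OF k bd(1)] cInf_lower[OF k bd(2)] by blast
  qed
  moreover have "\<exists>t\<in>E. \<exists>k::int. Sup S - e \<le> t + k \<and> t + k \<le> Sup S" if e: "0 < e" for e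
  proof -
    obtain s where s: "s \<in> S" "Sup S - e < s" using less_cSup_iff[OF ne bd(1), of "Sup S - e"] e by auto
    obtain t and k :: int where "t \<in> E" "s = t + k" using lift[OF s(1)] by blast
    then show ?thesis using s(2) cSup_upper[OF s(1) bd(1)] less_imp_le by blast
  qed
  moreover have "\<exists>t\<in>E. \<exists>k::int. Inf S \<le> t + k \<and> t + k \<le> Inf S + e" if e: "0 < e" for e
  proof -
    obtain s where s: "s \<in> S" "s < Inf S + e" using cInf_less_iff[OF ne bd(2), of "Inf S + e"] e by auto
    obtain t and k :: int where "t \<in> E" "s = t + k" using lift[OF s(1)] by blast
    then show ?thesis using s(2) cInf_lower[OF s(1) bd(2)] less_imp_le by blast
  qed
  ultimately have "shortest_arc E (Sup S) (Sup S - Inf S)"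
    unfolding shortest_arc_def diff_diff_eq2 add_diff_cancel_left' by blast
  then show ?thesis by blast
qed

lemma shortest_arc_width_nonneg: "shortest_arc E M w \<Longrightarrow> 0 \<le> w"
proof -
  assume t: "shortest_arc E M w"
  then obtain t0 where "t0 \<in> E" unfolding shortest_arc_def by (meson zero_less_one)
  then show ?thesis using t unfolding shortest_arc_def by force
qed

text \<open>
  Rotate \<open>E'\<close> into \<open>E\<close>. Its two end points are at distance \<open>w'\<close> and fall into an arc of length \<open>w\<close>, so at most \<open>w - w'\<close> is left
  on either side. As both lengths are at most \<open>1/4\<close>, this comparison of lengths modulo \<open>1\<close> is one of real numbers.
\<close>

lemma shortest_arc_translate:
  assumes E: "shortest_arc E M w" and E': "shortest_arc E' M' w'" and sub: "\<And>t. t \<in> E' \<Longrightarrow> t + s \<in> E"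
  shows "int_dist (M' + s - M) \<le> w - w'"
proof -
  have "int_dist (M' + s - M) \<le> w - w' + 3 * e" if e: "0 < e" "e < 1/8" for e
  proof -
    obtain t1 and k1 :: int where 1: "t1 \<in> E'" "M' - e \<le> t1 + k1" "t1 + k1 \<le> M'"
      using E' e(1) unfolding shortest_arc_def by blast
    obtain t2 and k2 :: int where 2: "t2 \<in> E'" "M' - w' \<le> t2 + k2" "t2 + k2 \<le> M' - w' + e"
      using E' e(1) unfolding shortest_arc_def by blast
    obtain l1 :: int where l1: "M - w \<le> t1 + s + l1" "t1 + s + l1 \<le> M"
      using E sub[OF 1(1)] unfolding shortest_arc_def by blast
    obtain l2 :: int where l2: "M - w \<le> t2 + s + l2" "t2 + s + l2 \<le> M"
      using E sub[OF 2(1)] unfolding shortest_arc_def by blast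
    have w: "w \<le> 1/4" "w' \<le> 1/4" using E E' by (simp_all add: shortest_arc_def)
    have w'0: "0 \<le> w'" using E' 1(1) unfolding shortest_arc_def by force
    \<comment> \<open>The distance of \<open>t1\<close> and \<open>t2\<close> is measured along both arcs; the two results agree modulo \<open>1\<close>, hence exactly.\<close>
    have "\<bar>of_int (k1 - k2 - l1 + l2) :: real\<bar> < 1"
      using 1 2 l1 l2 w w'0 e by simp
    then have "k1 - k2 - l1 + l2 = 0" by linarith
    then have j: "real_of_int k1 - k2 = real_of_int l1 - l2" by linarith
    have "int_dist (M' + s - M) \<le> \<bar>M' + s - M - of_int (k1 - l1)\<bar>" by (rule int_dist_le)
    also have "\<dots> \<le> w - w' + 3 * e" using 1 2 l1 l2 j e by simp
    finally show ?thesis .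
  qed
  then have *: "int_dist (M' + s - M) \<le> (w - w') + e" if "0 < e" for e
  proof -
    define d where "d = min (e / 3) (1/16)"
    have "0 < d" "d < 1/8" "3 * d \<le> e" using that by (auto simp: d_def)
    then show ?thesis using \<open>\<And>e. 0 < e \<Longrightarrow> e < 1/8 \<Longrightarrow> int_dist (M' + s - M) \<le> w - w' + 3 * e\<close>[of d] by linarith
  qed
  show ?thesis by (rule field_le_epsilon) (rule *)
qed

section \<open>From an eigenfunction to coboundaries\<close>

context directive
begin

text \<open>
  Uniform continuity by compactness: a cluster point \<open>y\<close> of pairs that violate the bound would contradict continuity at \<open>y\<close>.
\<close>

lemma uniform_circle:
  assumes g: "continuous_map (subtopology (full_shift (A n)) (level n)) euclidean g" and e: "0 < e"
  shows "\<exists>L::nat. \<forall>x\<in>level n. \<forall>x'\<in>level n. (\<forall>i\<in>{- int L..int L}. x' i = x i) \<longrightarrow>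
    int_dist (rep_circle (g x') - rep_circle (g x)) < e"
proof (rule ccontr)
  assume "\<not> ?thesis"
  then have "\<forall>L::nat. \<exists>x x'. x \<in> level n \<and> x' \<in> level n \<and> (\<forall>i\<in>{- int L..int L}. x' i = x i) \<and>
    \<not> int_dist (rep_circle (g x') - rep_circle (g x)) < e" by blast
  then obtain f f' where f: "\<And>L::nat. f L \<in> level n" "\<And>L. f' L \<in> level n"
    "\<And>L. \<forall>i\<in>{- int L..int L}. f' L i = f L i"
    "\<And>L. \<not> int_dist (rep_circle (g (f' L)) - rep_circle (g (f L))) < e" by metis
  obtain y where y: "range y \<subseteq> A n" "\<And>N j. \<exists>L\<ge>N. \<forall>i\<in>{-j..j}. f L i = y i"
    using cluster_sequence[of "A n" f] finite_A level_range[OF f(1)] by blast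
  have "\<exists>m>n. \<exists>a\<in>A m. sublist (factor y i j) (comp_subst \<tau> n m [a])" for i j
  proof -
    define J where "J = max \<bar>i\<bar> \<bar>j\<bar>"
    obtain L where L: "\<forall>i\<in>{-J..J}. f L i = y i" using y(2) by blast
    have "factor (f L) i j = factor y i j"
    proof (rule factor_cong)
      fix k assume "i \<le> k" "k < j"
      then have "k \<in> {-J..J}" by (auto simp: J_def)
      then show "f L k = y k" using L by blast
    qed
    moreover have "\<exists>m>n. \<exists>a\<in>A m. sublist (factor (f L) i j) (comp_subst \<tau> n m [a])"
      using f(1)[of L] unfolding level_shift_def by simp
    ultimately show ?thesis by simp
  qed
  then have yX: "y \<in> level n" using y(1) by (simp add: level_shift_def)
  obtain M :: nat where M: "\<And>x'. x' \<in> level n \<Longrightarrow> \<forall>i\<in>{- int M..int M}. x' i = y i \<Longrightarrow>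
    int_dist (rep_circle (g x') - rep_circle (g y)) < e / 2"
    using continuous_circleD[OF g level_range yX, of "e / 2"] e by auto
  obtain L where L: "L \<ge> M" "\<forall>i\<in>{- int M..int M}. f L i = y i" using y(2) by blast
  have "\<forall>i\<in>{- int M..int M}. f' L i = y i" using L f(3)[of L] by auto
  then have "int_dist (rep_circle (g (f L)) - rep_circle (g y)) < e / 2"
    "int_dist (rep_circle (g (f' L)) - rep_circle (g y)) < e / 2" using M f(1,2) L by blast+
  then have "int_dist (rep_circle (g (f' L)) - rep_circle (g (f L))) < e"
    using int_dist_triangle_diff[of "rep_circle (g (f' L))" "rep_circle (g (f L))" "rep_circle (g y)"]
      int_dist_minus_commute[of "rep_circle (g y)" "rep_circle (g (f L))"] by simp
  then show False using f(4) by blast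
qed

end

locale decisive_directive = primitive_directive +
  assumes dec: "decisive A \<tau>"
begin

lemma first_determined:
  assumes "[a, b] \<in> language (level (Suc n))" "[a, b'] \<in> language (level (Suc n))"
  shows "first n b = first n b'"
proof -
  obtain r where r: "\<And>a b. a \<in> A (Suc n) \<Longrightarrow> b \<in> A (Suc n) \<Longrightarrow> [a, b] \<in> language (level (Suc n)) \<Longrightarrow> prefix [r a] (\<tau> n [b])"
    using dec unfolding decisive_def by meson
  have "a \<in> A (Suc n)" "b \<in> A (Suc n)" "b' \<in> A (Suc n)" using assms language_lists by fastforce+
  then have "prefix [r a] (\<tau> n [b])" "prefix [r a] (\<tau> n [b'])" using r assms by blast+
  then show ?thesis by (auto simp: prefix_def)
qed

lemma last_determined:
  assumes "[a, b] \<in> language (level (Suc n))" "[a', b] \<in> language (level (Suc n))"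
  shows "last (\<tau> n [a]) = last (\<tau> n [a'])"
proof -
  obtain l where l: "\<And>a b. a \<in> A (Suc n) \<Longrightarrow> b \<in> A (Suc n) \<Longrightarrow> [a, b] \<in> language (level (Suc n)) \<Longrightarrow> suffix [l b] (\<tau> n [a])"
    using dec unfolding decisive_def by meson
  have "a \<in> A (Suc n)" "b \<in> A (Suc n)" "a' \<in> A (Suc n)" using assms language_lists by fastforce+
  then have "suffix [l b] (\<tau> n [a])" "suffix [l b] (\<tau> n [a'])" using l assms by blast+
  then show ?thesis by (auto simp: suffix_def)
qed

text \<open>
  The letter \<open>y\<^sub>0 = a\<close> determines the image from coordinate \<open>0\<close> to \<open>h\<^sub>n\<^sub>+\<^sub>1(a)\<close>. To the left, the letter \<open>y\<^sub>-\<^sub>1\<close> may vary, but the last letter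
  of \<open>\<tau>\<^sub>n(y\<^sub>-\<^sub>1)\<close> may not, and its image at level \<open>0\<close> is longer than \<open>L\<close>.
\<close>

lemma base_agree:
  assumes x: "x \<in> tower (Suc n) a 0" and x': "x' \<in> tower (Suc n) a 0" and a: "a \<in> A (Suc n)"
    and h1: "L < height \<tau> (Suc n) [a]" and h0: "\<And>b. b \<in> A n \<Longrightarrow> L < height \<tau> n [b]"
    and i: "i \<in> {- int L..int L}"
  shows "x i = x' i"
proof -
  let ?s = "comp_subst \<tau> 0 n" and ?t = "comp_subst \<tau> 0 (Suc n)"
  note s = subst_comp[of 0 n, simplified] and t = subst_comp[of 0 "Suc n"]
  obtain y where y: "y \<in> level (Suc n)" "y 0 = a" "x = subst_seq ?t y" using x unfolding tower_iff by auto
  obtain y' where y': "y' \<in> level (Suc n)" "y' 0 = a" "x' = subst_seq ?t y'" using x' unfolding tower_iff by auto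
  show ?thesis
  proof (cases "0 \<le> i")
    case True
    have "subst_seq ?t z i = ?t [a] ! nat i" if z: "z \<in> level (Suc n)" "z 0 = a" for z
      using subst_seq_nth[OF t level_range[OF z(1)], of 0 1 i] True i h1 cut_0[OF t, of z] factor_single[of z 0] z(2)
      by (simp add: cut_def height_def)
    then show ?thesis using y y' by (metis (no_types))
  next
    case False
    define e where "e = last (\<tau> n [y (-1)])"
    have val: "subst_seq ?t z i = ?s [last (\<tau> n [z (-1)])] ! nat (i + int (height \<tau> n [last (\<tau> n [z (-1)])]))"
      if z: "z \<in> level (Suc n)" for z
    proof -
      have r: "range z \<subseteq> A (Suc n)" by (rule level_range[OF z])
      define v where "v = subst_seq (\<tau> n) z"
      have rv: "range v \<subseteq> A n" unfolding v_def by (rule range_subst_seq[OF subst_step r])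
      have zv: "subst_seq ?t z = subst_seq ?s v" using subst_seq_comp[OF subst_step s r] by (simp add: v_def)
      have f1: "factor z (-1) 0 = [z (-1)]" using factor_single[of z "-1"] by simp
      have len: "0 < length (\<tau> n [z (-1)])" using substitution_nonempty[OF subst_step] level_letter[OF z] by simp
      have c: "cut (\<tau> n) z (-1) = - int (length (\<tau> n [z (-1)]))" by (simp add: cut_def f1)
      have "v (-1) = \<tau> n [z (-1)] ! nat (-1 - cut (\<tau> n) z (-1))"
        unfolding v_def using subst_seq_nth[OF subst_step r, of "-1" 0 "-1"] f1 c len cut_0[OF subst_step, of n z] by simp
      also have "nat (-1 - cut (\<tau> n) z (-1)) = length (\<tau> n [z (-1)]) - 1" using len unfolding c by linarith
      finally have v1: "v (-1) = last (\<tau> n [z (-1)])" using len by (simp add: last_conv_nth)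
      have f2: "factor v (-1) 0 = [v (-1)]" using factor_single[of v "-1"] by simp
      have c2: "cut ?s v (-1) = - int (height \<tau> n [v (-1)])" by (simp add: cut_def f2 height_def)
      have "L < height \<tau> n [v (-1)]" using h0 rv by blast
      then show ?thesis unfolding zv
        using subst_seq_nth[OF s rv, of "-1" 0 i] False i c2 f2 cut_0[OF s, of v] by (simp add: v1)
    qed
    have pair: "[z (-1), a] \<in> language (level (Suc n))" if z: "z \<in> level (Suc n)" "z 0 = a" for z
      unfolding language_pair_iff using level_translate[OF z(1), of "-1"] z(2)
      by (intro bexI[of _ "\<lambda>k. z (k + -1)"]) simp_all
    have "last (\<tau> n [y (-1)]) = last (\<tau> n [y' (-1)])"
      using last_determined pair y y' by blast
    then show ?thesis using val[OF y(1)] val[OF y'(1)] y(3) y'(3) by simp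
  qed
qed

lemma heights_unbounded: "\<exists>N. \<forall>n\<ge>N. \<forall>a\<in>A n. L < height \<tau> n [a]"
proof -
  have "filterlim (\<lambda>n. Min ((\<lambda>a. length (comp_subst \<tau> 0 n [a])) ` A n)) at_top sequentially"
    using dec by (simp add: decisive_def everywhere_growing_def)
  then have "eventually (\<lambda>n. Suc L \<le> Min ((\<lambda>a. length (comp_subst \<tau> 0 n [a])) ` A n)) sequentially"
    unfolding filterlim_at_top by (rule spec)
  then have "eventually (\<lambda>n. L < Min ((\<lambda>a. length (comp_subst \<tau> 0 n [a])) ` A n)) sequentially"
    by (simp only: Suc_le_eq)
  then obtain N where N: "\<And>n. n \<ge> N \<Longrightarrow> L < Min ((\<lambda>a. length (comp_subst \<tau> 0 n [a])) ` A n)"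
    unfolding eventually_sequentially by blast
  have "L < height \<tau> n [a]" if "n \<ge> N" "a \<in> A n" for n a
    unfolding height_def
    by (rule less_le_trans[OF N[OF that(1)]]) (simp add: Min_le finite_A that(2))
  then show ?thesis by blast
qed

lemma tower_subset_level: "x \<in> tower n a k \<Longrightarrow> x \<in> level 0"
  unfolding tower_iff using level_image[of 0 n] level_funpow by blast

lemma small_oscillation:
  assumes g: "continuous_map (subtopology (full_shift (A 0)) (level 0)) euclidean g" and e: "0 < e"
  shows "\<exists>N. \<forall>n\<ge>N. \<forall>a\<in>A n. \<forall>x\<in>tower n a 0. \<forall>x'\<in>tower n a 0.
    int_dist (rep_circle (g x') - rep_circle (g x)) < e"
proof -
  obtain L :: nat where L: "\<And>x x'. x \<in> level 0 \<Longrightarrow> x' \<in> level 0 \<Longrightarrow> \<forall>i\<in>{- int L..int L}. x' i = x i \<Longrightarrow>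
    int_dist (rep_circle (g x') - rep_circle (g x)) < e" using uniform_circle[OF g e] by blast
  obtain N where N: "\<And>n a. n \<ge> N \<Longrightarrow> a \<in> A n \<Longrightarrow> L < height \<tau> n [a]" using heights_unbounded by blast
  have "int_dist (rep_circle (g x') - rep_circle (g x)) < e"
    if n: "n \<ge> Suc N" and a: "a \<in> A n" and x: "x \<in> tower n a 0" and x': "x' \<in> tower n a 0" for n a x x'
  proof -
    obtain m where m: "n = Suc m" "m \<ge> N" using n by (cases n) auto
    have "x' i = x i" if "i \<in> {- int L..int L}" for i
      using base_agree[of x' m a x L i] x x' a N[OF m(2)] N[of n a] n that m(1) by simp
    then show ?thesis using L tower_subset_level x x' by blast
  qed
  then show ?thesis by blast
qed

lemma tower_0_nonempty: "a \<in> A n \<Longrightarrow> tower n a 0 \<noteq> {}"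
  using letter_occurs[of a n] tower_iff[of _ n a 0] by fastforce

lemma tower_first:
  assumes "x \<in> tower (Suc n) a 0" "a \<in> A (Suc n)"
  shows "x \<in> tower n (first n a) 0"
proof -
  obtain z where z: "z \<in> level n" "factor z 0 (int (length (\<tau> n [a]))) = \<tau> n [a]" "x = subst_seq (comp_subst \<tau> 0 n) z"
    using tower_desubst[of n "Suc n" x a 0] assms(1) by (auto simp: comp_subst_refl)
  have "z 0 = first n a"
    using factor_prefix(2)[OF z(2), of "[]" "\<tau> n [a]"] substitution_nonempty[OF subst_step assms(2)] by simp
  then show ?thesis using z unfolding tower_iff by auto
qed

context
  fixes g :: "(int \<Rightarrow> 'a) \<Rightarrow> circle" and \<alpha> :: real
  assumes g: "continuous_map (subtopology (full_shift (A 0)) (level 0)) euclidean g"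
    and eig: "\<And>x. x \<in> level 0 \<Longrightarrow> g (shift x) = g x + to_circle \<alpha>"
begin

lemma eigen_iterate: "x \<in> level 0 \<Longrightarrow> g ((shift ^^ k) x) = g x + to_circle (\<alpha> * real k)"
proof (induction k)
  case 0
  have "to_circle 0 = 0" by (simp add: zero_circle.abs_eq)
  then show ?case by simp
next
  case (Suc k)
  have "to_circle (\<alpha> * real (Suc k)) = to_circle (\<alpha> * real k) + to_circle \<alpha>"
    unfolding to_circle_add[symmetric] by (simp add: algebra_simps)
  then show ?case using Suc eig[OF level_funpow[OF Suc.prems, of k]] by (simp add: add.assoc)
qed

text \<open>
  All real lifts of the values of the eigenfunction on a base; working with lifts avoids any order on the circle.
\<close>

definition lifted_values where "lifted_values n a = {t. \<exists>x\<in>tower n a 0. to_circle t = g x}"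

lemma shortest_arc_of_inclusion:
  assumes "shortest_arc (lifted_values n b) M w" "shortest_arc (lifted_values m a) M' w'"
    and sub: "\<And>x. x \<in> tower m a 0 \<Longrightarrow> (shift ^^ h) x \<in> tower n b 0"
  shows "int_dist (M' + \<alpha> * real h - M) \<le> w - w'"
proof (rule shortest_arc_translate[OF assms(1,2)])
  fix t assume "t \<in> lifted_values m a"
  then obtain x where x: "x \<in> tower m a 0" "to_circle t = g x" by (auto simp: lifted_values_def)
  then have "to_circle (t + \<alpha> * real h) = g ((shift ^^ h) x)"
    using eigen_iterate[OF tower_subset_level[OF x(1)]] to_circle_add by simp
  then show "t + \<alpha> * real h \<in> lifted_values n b" using sub[OF x(1)] unfolding lifted_values_def by blast
qed

lemma lifted_values_shortest_arc: "\<exists>N M w. \<forall>n\<ge>N. \<forall>a\<in>A n. shortest_arc (lifted_values n a) (M n a) (w n a)"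
proof -
  obtain N where N: "\<And>n a x x'. n \<ge> N \<Longrightarrow> a \<in> A n \<Longrightarrow> x \<in> tower n a 0 \<Longrightarrow> x' \<in> tower n a 0 \<Longrightarrow>
    int_dist (rep_circle (g x') - rep_circle (g x)) < 1/8"
    using small_oscillation[OF g, of "1/8"] by (meson zero_less_divide_1_iff zero_less_numeral)
  have "\<exists>M w. shortest_arc (lifted_values n a) M w" if n: "n \<ge> N" and a: "a \<in> A n" for n a
  proof (rule shortest_arc_exists)
    obtain x where "x \<in> tower n a 0" using tower_0_nonempty[OF a] by blast
    then have "rep_circle (g x) \<in> lifted_values n a" unfolding lifted_values_def using to_circle_rep by blast
    then show "lifted_values n a \<noteq> {}" by blast
    fix s t assume "s \<in> lifted_values n a" "t \<in> lifted_values n a"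
    then obtain x x' where x: "x \<in> tower n a 0" "to_circle t = g x" "x' \<in> tower n a 0" "to_circle s = g x'"
      by (auto simp: lifted_values_def)
    have "rep_circle (g x') - s \<in> \<int>" "rep_circle (g x) - t \<in> \<int>" using rep_to_circle x by metis+
    then have "(rep_circle (g x') - s) - (rep_circle (g x) - t) \<in> \<int>" by (rule Ints_diff)
    then have "(rep_circle (g x') - rep_circle (g x)) - (s - t) \<in> \<int>" by (simp add: algebra_simps)
    then show "int_dist (s - t) < 1/8" using int_dist_cong N[OF n a x(1,3)] by metis
  qed
  then show ?thesis by metis
qed

text \<open>
  For the finitely many levels on which the image of a base need not fit into a short arc, the zero coboundary is taken; they do not
  affect summability.
\<close>

lemma coboundaries_of_eigenfunction:
  "\<exists>c. (\<forall>n. letter_coboundary (A n) (level n) (c n)) \<and> summable (error c \<alpha>)"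
proof -
  obtain N M w where T: "\<And>n a. n \<ge> N \<Longrightarrow> a \<in> A n \<Longrightarrow> shortest_arc (lifted_values n a) (M n a) (w n a)"
    using lifted_values_shortest_arc by blast
  \<comment> \<open>By \<open>first_determined\<close> all letters \<open>b\<close> that follow \<open>a\<close> give the same value.\<close>
  define r where "r n a = first n (SOME b. [a, b] \<in> language (level (Suc n)))" for n a
  have r: "r n a = first n b" if "[a, b] \<in> language (level (Suc n))" for n a b
    unfolding r_def by (rule first_determined[OF someI[of _ b] that]) (rule that)
  define c where "c n u = (if n \<le> N then 0 else
    sum_list (map (\<lambda>a. M (n - 1) (r (n - 1) a) - M (n - 1) (first (n - 1) a)) u))" for n u
  have cN: "c n [] = 0" and ca: "c n (u @ v) = c n u + c n v" for n u v
    by (simp_all add: c_def)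
  define \<rho> where "\<rho> n b = (if n \<le> N then 0 else M (n - 1) (first (n - 1) b))" for n b
  have pot: "potential n (c n) (\<rho> n)" for n
    unfolding potential_def
  proof (intro allI impI)
    fix a b assume L: "[a, b] \<in> language (level n)"
    show "c n [a] = \<rho> n b - \<rho> n a"
    proof (cases "n \<le> N")
      case False
      then have "n = Suc (n - 1)" by simp
      then show ?thesis using r[of a b "n - 1"] L False by (simp add: c_def \<rho>_def)
    qed (simp add: c_def \<rho>_def)
  qed
  have cob: "letter_coboundary (A n) (level n) (c n)" for n
    by (rule potential_coboundary[OF cN ca pot])
  have step: "w (Suc n) a \<le> w n b" if n: "n \<ge> N" and a: "a \<in> A (Suc n)" and b: "b \<in> A n" for n a b
  proof -
    obtain u v where uv: "\<tau> n [a] = u @ b # v" using split_list[OF letter_in_image[OF a b]] by blast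
    have "(shift ^^ height \<tau> n u) x \<in> tower n b 0" if x: "x \<in> tower (Suc n) a 0" for x
    proof -
      obtain z where z: "z \<in> level n" "factor z 0 (int (length (\<tau> n [a]))) = \<tau> n [a]"
        "x = subst_seq (comp_subst \<tau> 0 n) z"
        using tower_desubst[of n "Suc n" x a 0] x by (auto simp: comp_subst_refl)
      then show ?thesis using tower_shift_word[OF z(1) factor_prefix(1)[OF z(2) uv]]
        factor_prefix(2)[OF z(2) uv] by simp
    qed
    then have "int_dist (M (Suc n) a + \<alpha> * real (height \<tau> n u) - M n b) \<le> w n b - w (Suc n) a"
      by (rule shortest_arc_of_inclusion[OF T[OF n b] T[OF le_SucI[OF n] a]])
    then show ?thesis using int_dist_nonneg[of "M (Suc n) a + \<alpha> * real (height \<tau> n u) - M n b"] by linarith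
  qed
  define W where "W n = Max (w n ` A n)" for n
  have wW: "w n a \<le> W n" if "a \<in> A n" for n a using that finite_A by (simp add: W_def)
  have Ww: "W (Suc n) \<le> w n b" if "n \<ge> N" "b \<in> A n" for n b
    unfolding W_def using step[OF that(1) _ that(2)] finite_A A_nonempty by simp
  have W0: "0 \<le> W n" if "n \<ge> N" for n
  proof -
    obtain a where a: "a \<in> A n" using A_nonempty by blast
    have t: "shortest_arc (lifted_values n a) (M n a) (w n a)" by (rule T[OF that a])
    show ?thesis using wW[OF a] shortest_arc_width_nonneg[OF t] by linarith
  qed
  have err: "error c \<alpha> (Suc p) \<le> 2 * (W p - W (p + 4))" if p: "p \<ge> N" for p
  proof (rule error_leI)
    fix a u assume a: "a \<in> A (Suc p + 2)" and u: "prefix u (\<tau> (Suc p) (\<tau> (Suc (Suc p)) [a]))"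
    define n where "n = Suc p"
    have a3: "a \<in> A (p + 3)" using a by (simp add: numeral_3_eq_3)
    define V where "V = comp_subst \<tau> n (p + 3) [a]"
    have Veq: "V = \<tau> n (\<tau> (Suc n) [a])"
      using comp_subst_two[of n "[a]"] by (simp add: V_def n_def numeral_3_eq_3)
    obtain v where V: "V = u @ v" using u by (auto simp: prefix_def Veq n_def)
    have Vne: "V \<noteq> []" using substitution_nonempty[OF subst_comp[of n "p + 3"] a3] by (simp add: V_def n_def)
    have desub: "\<exists>z\<in>level n. factor z 0 (int (length V)) = V \<and> x = subst_seq (comp_subst \<tau> 0 n) z"
      if "x \<in> tower (p + 3) a 0" for x
      using tower_desubst[of n "p + 3" x a 0] that by (simp add: V_def n_def)
    have word: "u @ [z (int (length u))] \<in> language (level n)"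
      if z: "z \<in> level n" "factor z 0 (int (length V)) = V" for z
    proof -
      have "factor z 0 (int (length u) + 1) = u @ [z (int (length u))]"
        using factor_append[of 0 "int (length u)" "int (length u) + 1" z] factor_prefix(1)[OF z(2) V] by simp
      then show ?thesis using factor_in_language[OF z(1)] by metis
    qed
    have z0: "z 0 = hd V" if z: "z \<in> level n" "factor z 0 (int (length V)) = V" for z
      using factor_prefix(2)[OF z(2), of "[]" V] Vne by simp
    obtain x0 where x0: "x0 \<in> tower (p + 3) a 0" using tower_0_nonempty[OF a3] by blast
    obtain y where y: "y \<in> level n" "factor y 0 (int (length V)) = V" using desub[OF x0] by blast
    define b where "b = y (int (length u))"
    have b: "b \<in> A n" unfolding b_def by (rule level_letter[OF y(1)])
    have hV: "hd V \<in> A n" using z0[OF y] level_letter[OF y(1), of 0] by simp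
    have hub: "hd (u @ [b]) = hd V"
      using z0[OF y] V by (cases u) (auto simp: b_def)
    \<comment> \<open>If \<open>u\<close> is the whole word, the next letter depends on the point, but its \<open>first\<close> does not.\<close>
    have fb: "first p (z (int (length u))) = first p b"
      if z: "z \<in> level n" "factor z 0 (int (length V)) = V" for z
    proof (cases u rule: rev_cases)
      case Nil
      then show ?thesis using z0[OF z] z0[OF y] by (simp add: b_def)
    next
      case (snoc u' d)
      have "[d, z (int (length u))] \<in> language (level n)"
        by (rule language_sublist[OF word[OF z]])
          (use sublist_appendI[of "[d, z (int (length u))]" u' "[]"] snoc in simp)
      moreover have "[d, b] \<in> language (level n)"
        by (rule language_sublist[OF word[OF y]])
          (use sublist_appendI[of "[d, b]" u' "[]"] snoc b_def in simp)
      ultimately show ?thesis unfolding n_def by (rule first_determined)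
    qed
    have cu: "c n u = M p (first p b) - M p (first p (hd V))"
      using potential_telescope[OF cN ca pot word[OF y, folded b_def]] p hub by (simp add: \<rho>_def n_def)
    have f: "first p d \<in> A p" if "d \<in> A n" for d
      using substitution_lists[OF subst_step, of "[d]" p] substitution_nonempty[OF subst_step, of d p] that
      by (metis Cons_in_lists_iff in_lists_conv_set list.set_sel(1) lists.Nil n_def)
    have m1: "(shift ^^ 0) x \<in> tower p (first p (hd V)) 0"
      and m2: "(shift ^^ height \<tau> n u) x \<in> tower p (first p b) 0" if x: "x \<in> tower (p + 3) a 0" for x
    proof -
      obtain z where z: "z \<in> level n" "factor z 0 (int (length V)) = V" "x = subst_seq (comp_subst \<tau> 0 n) z"
        using desub[OF x] by blast
      have "x \<in> tower n (hd V) 0" unfolding tower_iff using z z0 by auto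
      then show "(shift ^^ 0) x \<in> tower p (first p (hd V)) 0"
        using tower_first[of x p "hd V"] hV by (simp add: n_def)
      have "(shift ^^ height \<tau> n u) x \<in> tower n (z (int (length u))) 0"
        using tower_shift_word[OF z(1) factor_prefix(1)[OF z(2) V]] z(3) by simp
      then have "(shift ^^ height \<tau> n u) x \<in> tower p (first p (z (int (length u)))) 0"
        using tower_first[of _ p] level_letter[OF z(1)] unfolding n_def by blast
      then show "(shift ^^ height \<tau> n u) x \<in> tower p (first p b) 0" using fb[OF z(1,2)] by simp
    qed
    have p3: "p + 3 \<ge> N" using p by simp
    have i1: "int_dist (M (p + 3) a + \<alpha> * real 0 - M p (first p (hd V))) \<le> w p (first p (hd V)) - w (p + 3) a"
      by (rule shortest_arc_of_inclusion[OF T[OF p f[OF hV]] T[OF p3 a3] m1])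
    have i2: "int_dist (M (p + 3) a + \<alpha> * real (height \<tau> n u) - M p (first p b)) \<le> w p (first p b) - w (p + 3) a"
      by (rule shortest_arc_of_inclusion[OF T[OF p f[OF b]] T[OF p3 a3] m2])
    have "c n u - \<alpha> * real (height \<tau> n u) =
      (M (p + 3) a + \<alpha> * real 0 - M p (first p (hd V))) + - (M (p + 3) a + \<alpha> * real (height \<tau> n u) - M p (first p b))"
      using cu by simp
    then have "int_dist (c n u - \<alpha> * real (height \<tau> n u)) \<le>
      (w p (first p (hd V)) - w (p + 3) a) + (w p (first p b) - w (p + 3) a)"
      using i1 i2 int_dist_triangle int_dist_minus by (smt (verit))
    also have "\<dots> \<le> (W p - w (p + 3) a) + (W p - w (p + 3) a)"
      by (intro add_mono diff_right_mono wW f hV b)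
    also have "\<dots> \<le> (W p - W (p + 4)) + (W p - W (p + 4))"
    proof (intro add_mono diff_left_mono)
      show "W (p + 4) \<le> w (p + 3) a" using Ww[OF p3 a3] by (simp add: numeral_eq_Suc)
      then show "W (p + 4) \<le> w (p + 3) a" .
    qed
    finally show "int_dist (c (Suc p) u - \<alpha> * real (height \<tau> (Suc p) u)) \<le> 2 * (W p - W (p + 4))"
      by (simp add: n_def)
  qed
  \<comment> \<open>Four consecutive terms turn \<open>W\<^sub>p - W\<^sub>p\<^sub>+\<^sub>4\<close> into a difference of neighbours.\<close>
  define Z where "Z i = W (i + N) + W (i + N + 1) + W (i + N + 2) + W (i + N + 3)" for i
  have Wdec: "W (Suc n) \<le> W n" if n: "n \<ge> N" for n
  proof -
    obtain b where "b \<in> A n" using A_nonempty by blast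
    then show ?thesis using Ww[OF n] wW by (meson order_trans)
  qed
  have "Z (Suc i) \<le> Z i" for i
    using Wdec[of "i + N"] Wdec[of "i + N + 1"] Wdec[of "i + N + 2"] Wdec[of "i + N + 3"]
    by (simp add: Z_def numeral_eq_Suc)
  then have "decseq Z" by (rule decseq_SucI)
  moreover have "0 \<le> Z i" for i unfolding Z_def using W0 by simp
  ultimately obtain l where "Z \<longlonglongrightarrow> l" using decseq_convergent[of Z 0] by blast
  then have "summable (\<lambda>i. 2 * (Z i - Z (Suc i)))" by (intro summable_mult telescope_summable')
  then have "summable (\<lambda>i. error c \<alpha> (i + Suc N))"
  proof (rule summable_comparison_test')
    fix i
    have "error c \<alpha> (i + Suc N) \<le> 2 * (Z i - Z (Suc i))"
      using err[of "i + N"] by (simp add: Z_def algebra_simps numeral_eq_Suc)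
    then show "norm (error c \<alpha> (i + Suc N)) \<le> 2 * (Z i - Z (Suc i))"
      using error_nonneg[of c \<alpha> "i + Suc N"] by simp
  qed
  then have "summable (error c \<alpha>)" by (rule summable_iff_shift[THEN iffD1])
  then show ?thesis using cob by blast
qed

end

end

theorem theorem5p3:
  fixes A :: "nat \<Rightarrow> 'a set"
    and \<tau> :: "nat \<Rightarrow> 'a list \<Rightarrow> 'a list"
    and X :: "(int \<Rightarrow> 'a) set"
    and \<alpha> :: real
  assumes "directive_sequence A \<tau>"
    and "letters_occur A \<tau>"
    and "subshift (A 0) X"
    and "generates A \<tau> X"
    and "recognizable A \<tau>"
    and "decisive A \<tau>"
    and "\<And>n a u. a \<in> A (Suc n) \<Longrightarrow> u \<in> language (level_shift A \<tau> n) \<Longrightarrow> length u = 2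
           \<Longrightarrow> sublist u (\<tau> n [a])"
  shows "eigenvalue (A 0) X \<alpha> \<longleftrightarrow>
    (\<exists>c :: nat \<Rightarrow> 'a list \<Rightarrow> real.
      (\<forall>n. letter_coboundary (A n) (level_shift A \<tau> n) (c n)) \<and>
      summable (\<lambda>n. Max {int_dist (c n u - \<alpha> * real (height \<tau> n u)) | a u.
        a \<in> A (n + 2) \<and> prefix u (comp_subst \<tau> n (n + 2) [a])}))"
proof -
  interpret decisive_directive A \<tau>
    by unfold_locales (use assms in blast)+
  have X: "X = level_shift A \<tau> 0" using assms(4) by (simp add: generates_def)
  show ?thesis
    unfolding X error_def[symmetric]
  proof
    assume "eigenvalue (A 0) (level_shift A \<tau> 0) \<alpha>"
    then obtain g where "continuous_map (subtopology (full_shift (A 0)) (level_shift A \<tau> 0)) euclidean g"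
      "\<And>x. x \<in> level_shift A \<tau> 0 \<Longrightarrow> g (shift x) = g x + to_circle \<alpha>"
      unfolding eigenvalue_def by blast
    then show "\<exists>c. (\<forall>n. letter_coboundary (A n) (level_shift A \<tau> n) (c n)) \<and> summable (\<lambda>n. error c \<alpha> n)"
      by (rule coboundaries_of_eigenfunction)
  next
    assume "\<exists>c. (\<forall>n. letter_coboundary (A n) (level_shift A \<tau> n) (c n)) \<and> summable (\<lambda>n. error c \<alpha> n)"
    then show "eigenvalue (A 0) (level_shift A \<tau> 0) \<alpha>"
      using eigenvalue_of_coboundaries by blast
  qed
qed

end
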